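(* Let $(M,\omega)$ and $(M_1,\omega_1)$ be symplectic manifolds of dimension $2n$, let $0\le l\le n$, and let $\sigma:M\to M_1$ be a symplectomorphism. Let $\nabla$ be a symplectic connection on $M$ and let $\nabla^1=\sigma\cdot\nabla$, a symplectic connection on $M_1$. Let $\Sigma:\mathcal Z^l_M\to\mathcal Z^l_{M_1}$ be the map $\Sigma(j)=d\sigma\circ j\circ d\sigma^{-1}$, which covers $\sigma$. Then $\Sigma:(\mathcal Z^l_M,\mathcal J^{\nabla})\to(\mathcal Z^l_{M_1},\mathcal J^{\nabla^1})$ is pseudo-holomorphic.
   Context: A symplectic connection on a symplectic manifold $(M,\omega)$ is a torsion-free linear connection $\nabla$ on $TM$ with $\nabla\omega=0$. For a diffeomorphism $\sigma:M\to M_1$ and a linear connection $\nabla$ on $M$, $\sigma\cdot\nabla$ is the linear connection on $M_1$ given by $(\sigma\cdot\nabla)_XY=\sigma\cdot\left(\nabla_{\sigma^{-1}\cdot X}(\sigma^{-1}\cdot Y)\right)$, where $(\sigma\cdot Z)_y=d\sigma(Z_{\sigma^{-1}(y)})$ is the push-forward of vector fields. If $\sigma$ is a symplectomorphism and $\nabla$ is symplectic, then $\sigma\cdot\nabla$ is symplectic. Twistor space: for $(M,\omega)$ of dimension $2n$ and $0\le l\le n$, $\pi:\mathcal Z^l=\mathcal Z^l_M\to M$ is the bundle whose fibre over $x$ consists of all real endomorphisms $j$ of $T_xM$ with $j^2=-\mathrm{Id}$, $\omega(j\cdot,j\cdot)=\omega$, and such that the symmetric form $\omega(\cdot,j\cdot)$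 has signature $(2n-2l,2l)$. Let $E=\pi^*TM$ and let $\Phi$ be the tautological section of $\mathrm{End}\,E$, $\Phi_j=j$. A symplectic connection $\nabla$ gives the horizontal distribution $\mathcal H^\nabla=\{X\in T\mathcal Z^l:(\pi^*\nabla)_X\Phi=0\}$, complementary to $\mathcal V=\ker d\pi$. The almost complex structure $\mathcal J^\nabla=(J^h,J^v)$ on $\mathcal Z^l$ preserves $\mathcal H^\nabla\oplus\mathcal V$; at $j$, $J^h=(d\pi)^{-1}\circ j\circ d\pi$ on $\mathcal H^\nabla_j\cong T_{\pi(j)}M$, and on $\mathcal V_j$ (whose elements are regarded as endomorphisms of $T_{\pi(j)}M$ anticommuting with $j$) $J^v$ is left multiplication by $j$. *)

theory Defs
  imports "HOL-Analysis.Analysis" "HOL-Library.Function_Algebras"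
begin

text \<open>
  Functions are added and multiplied pointwise (\<^theory>\<open>HOL-Library.Function_Algebras\<close>), in particular
  real functions on a manifold, tangent vectors and vector fields; \<open>0\<close> is the zero function.
\<close>

section \<open>Smooth manifolds\<close>

text \<open>\<open>C\<^sup>k\<close> and \<open>C\<^sup>\<infinity>\<close> maps on an open subset of a finite-dimensional normed space.\<close>

primrec Ck_on :: "nat \<Rightarrow> ('a::real_normed_vector \<Rightarrow> 'b::real_normed_vector) \<Rightarrow> 'a set \<Rightarrow> bool" where
  "Ck_on 0 f S \<longleftrightarrow> continuous_on S f"
| "Ck_on (Suc k) f S \<longleftrightarrow>
     (\<forall>x\<in>S. f differentiable (at x)) \<and> (\<forall>v. Ck_on k (\<lambda>x. frechet_derivative f (at x) v) S)"

definition Cinf_on :: "('a::real_normed_vector \<Rightarrow> 'b::real_normed_vector) \<Rightarrow> 'a set \<Rightarrow> bool" where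
  "Cinf_on f S \<longleftrightarrow> (\<forall>k. Ck_on k f S)"

text \<open>
  A chart is a domain together with a coordinate map; the values of the coordinate map outside the
  domain are irrelevant.
\<close>

type_synonym ('a, 'e) chart = "'a set \<times> ('a \<Rightarrow> 'e)"
type_synonym ('a, 'e) atlas = "('a, 'e) chart set"

definition is_chart :: "('a, 'e::real_normed_vector) chart \<Rightarrow> bool" where
  "is_chart = (\<lambda>(U, \<phi>). inj_on \<phi> U \<and> open (\<phi> ` U))"

definition compatible_charts ::
    "('a, 'e::real_normed_vector) chart \<Rightarrow> ('a, 'e) chart \<Rightarrow> bool" where
  "compatible_charts = (\<lambda>(U, \<phi>) (V, \<psi>).
     open (\<phi> ` (U \<inter> V)) \<and> open (\<psi> ` (U \<inter> V)) \<and>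
     Cinf_on (\<psi> \<circ> inv_into U \<phi>) (\<phi> ` (U \<inter> V)) \<and>
     Cinf_on (\<phi> \<circ> inv_into V \<psi>) (\<psi> ` (U \<inter> V)))"

definition points :: "('a, 'e) atlas \<Rightarrow> 'a set" where
  "points M = \<Union> (fst ` M)"

definition manifold_topology :: "('a, 'e::real_normed_vector) atlas \<Rightarrow> 'a topology" where
  "manifold_topology M =
     topology_generated_by {W. \<exists>(U, \<phi>)\<in>M. W \<subseteq> U \<and> open (\<phi> ` W)}"

text \<open>A smooth manifold is given by its maximal atlas \<open>M\<close>; its dimension is that of the model space.\<close>

definition smooth_manifold :: "('a, 'e::euclidean_space) atlas \<Rightarrow> bool" where
  "smooth_manifold M \<longleftrightarrow>
     (\<forall>c\<in>M. is_chart c) \<and>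
     (\<forall>c\<in>M. \<forall>d\<in>M. compatible_charts c d) \<and>
     (\<forall>c. fst c \<subseteq> points M \<and> is_chart c \<and> (\<forall>d\<in>M. compatible_charts c d) \<longrightarrow> c \<in> M) \<and>
     Hausdorff_space (manifold_topology M) \<and> second_countable (manifold_topology M)"

text \<open>
  Smoothness of a map from a subset \<open>S\<close> of the manifold with atlas \<open>A\<close> to a subset \<open>T\<close> of the manifold
  with atlas \<open>B\<close>: locally, in charts, the map is the restriction to \<open>S\<close> of a smooth map. If \<open>S\<close> and
  \<open>T\<close> are the whole manifolds (or embedded submanifolds) this is the usual notion. The atlases need
  not be maximal.
\<close>

definition smooth_map ::
    "('a, 'e::real_normed_vector) atlas \<Rightarrow> 'a set \<Rightarrow> ('b, 'f::real_normed_vector) atlas \<Rightarrow> 'b set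
      \<Rightarrow> ('a \<Rightarrow> 'b) \<Rightarrow> bool" where
  "smooth_map A S B T f \<longleftrightarrow> f ` S \<subseteq> T \<and>
     (\<forall>p\<in>S. \<exists>(U, \<phi>)\<in>A. \<exists>(V, \<psi>)\<in>B. \<exists>W g. p \<in> U \<and> f p \<in> V \<and>
        open W \<and> \<phi> p \<in> W \<and> Cinf_on g W \<and>
        (\<forall>q\<in>S \<inter> U. \<phi> q \<in> W \<longrightarrow> f q \<in> V \<and> \<psi> (f q) = g (\<phi> q)))"

definition smooth_funs :: "('a, 'e::real_normed_vector) atlas \<Rightarrow> 'a set \<Rightarrow> ('a \<Rightarrow> real) set" where
  "smooth_funs A S = {f. smooth_map A S {(UNIV, \<lambda>x::real. x)} UNIV f}"

abbreviation Cinf :: "('a, 'e::real_normed_vector) atlas \<Rightarrow> ('a \<Rightarrow> real) set" where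
  "Cinf M \<equiv> smooth_funs M (points M)"

definition diffeomorphism ::
    "('a, 'e::real_normed_vector) atlas \<Rightarrow> ('b, 'e) atlas \<Rightarrow> ('a \<Rightarrow> 'b) \<Rightarrow> bool" where
  "diffeomorphism M M1 \<sigma> \<longleftrightarrow> bij_betw \<sigma> (points M) (points M1) \<and>
     smooth_map M (points M) M1 (points M1) \<sigma> \<and>
     smooth_map M1 (points M1) M (points M) (inv_into (points M) \<sigma>)"

section \<open>Tangent vectors, vector fields, connections\<close>

text \<open>
  In the following, \<open>F\<close> is the algebra of smooth functions of a manifold \<open>S\<close>. Tangent vectors at \<open>p\<close>
  are the derivations of \<open>F\<close> at \<open>p\<close>, extended by \<open>0\<close> to all real functions. (Whether a function
  belongs to \<open>F\<close> depends on its restriction to \<open>S\<close> only, and the Leibniz rule implies that the same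
  holds for the value of a derivation: apply it to the product with the indicator function of the
  complement of \<open>S\<close>, which belongs to \<open>F\<close>.)
\<close>

type_synonym 'a tvec = "('a \<Rightarrow> real) \<Rightarrow> real"

definition smul :: "real \<Rightarrow> 'a tvec \<Rightarrow> 'a tvec" where
  "smul c v = (\<lambda>f. c * v f)"

definition tangent_space :: "('a \<Rightarrow> real) set \<Rightarrow> 'a \<Rightarrow> 'a tvec set" where
  "tangent_space F p = {v.
     (\<forall>f\<in>F. \<forall>g\<in>F. v (f + g) = v f + v g) \<and>
     (\<forall>c. \<forall>f\<in>F. v (\<lambda>q. c * f q) = c * v f) \<and>
     (\<forall>f\<in>F. \<forall>g\<in>F. v (f * g) = v f * g p + f p * v g) \<and>
     (\<forall>f. f \<notin> F \<longrightarrow> v f = 0)}"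

abbreviation tangent :: "('a, 'e::real_normed_vector) atlas \<Rightarrow> 'a \<Rightarrow> 'a tvec set" where
  "tangent M p \<equiv> tangent_space (Cinf M) p"

text \<open>The differential of a map into a manifold with algebra of smooth functions \<open>G\<close>.\<close>

definition differential :: "('b \<Rightarrow> real) set \<Rightarrow> ('a \<Rightarrow> 'b) \<Rightarrow> 'a tvec \<Rightarrow> 'b tvec" where
  "differential G f v = (\<lambda>g. if g \<in> G then v (g \<circ> f) else 0)"

text \<open>Smooth vector fields are extended by \<open>0\<close> outside the manifold.\<close>

definition vector_fields :: "('a \<Rightarrow> real) set \<Rightarrow> 'a set \<Rightarrow> ('a \<Rightarrow> 'a tvec) set" where
  "vector_fields F S = {X.
     (\<forall>p\<in>S. X p \<in> tangent_space F p) \<and> (\<forall>p. p \<notin> S \<longrightarrow> X p = 0) \<and>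
     (\<forall>f\<in>F. (\<lambda>p. X p f) \<in> F)}"

abbreviation vfields :: "('a, 'e::real_normed_vector) atlas \<Rightarrow> ('a \<Rightarrow> 'a tvec) set" where
  "vfields M \<equiv> vector_fields (Cinf M) (points M)"

definition fmul :: "('a \<Rightarrow> real) \<Rightarrow> ('a \<Rightarrow> 'b tvec) \<Rightarrow> 'a \<Rightarrow> 'b tvec" where
  "fmul f X = (\<lambda>p. smul (f p) (X p))"

definition lie_bracket :: "('a \<Rightarrow> 'a tvec) \<Rightarrow> ('a \<Rightarrow> 'a tvec) \<Rightarrow> 'a \<Rightarrow> 'a tvec" where
  "lie_bracket X Y = (\<lambda>p f. X p (\<lambda>q. Y q f) - Y p (\<lambda>q. X q f))"

definition push_vfield ::
    "('a, 'e::real_normed_vector) atlas \<Rightarrow> ('b, 'e) atlas \<Rightarrow> ('a \<Rightarrow> 'b)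
      \<Rightarrow> ('a \<Rightarrow> 'a tvec) \<Rightarrow> 'b \<Rightarrow> 'b tvec" where
  "push_vfield M M1 \<sigma> X =
     (\<lambda>y. if y \<in> points M1 then differential (Cinf M1) \<sigma> (X (inv_into (points M) \<sigma> y)) else 0)"

type_synonym 'a conn = "('a \<Rightarrow> 'a tvec) \<Rightarrow> ('a \<Rightarrow> 'a tvec) \<Rightarrow> 'a \<Rightarrow> 'a tvec"

definition linear_connection :: "('a, 'e::real_normed_vector) atlas \<Rightarrow> 'a conn \<Rightarrow> bool" where
  "linear_connection M nabla \<longleftrightarrow>
     (\<forall>X\<in>vfields M. \<forall>Y\<in>vfields M. nabla X Y \<in> vfields M) \<and>
     (\<forall>X\<in>vfields M. \<forall>X'\<in>vfields M. \<forall>Y\<in>vfields M. nabla (X + X') Y = nabla X Y + nabla X' Y) \<and>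
     (\<forall>X\<in>vfields M. \<forall>Y\<in>vfields M. \<forall>Y'\<in>vfields M. nabla X (Y + Y') = nabla X Y + nabla X Y') \<and>
     (\<forall>f\<in>Cinf M. \<forall>X\<in>vfields M. \<forall>Y\<in>vfields M. nabla (fmul f X) Y = fmul f (nabla X Y)) \<and>
     (\<forall>f\<in>Cinf M. \<forall>X\<in>vfields M. \<forall>Y\<in>vfields M.
        nabla X (fmul f Y) = fmul (\<lambda>p. X p f) Y + fmul f (nabla X Y))"

definition torsion_free :: "('a, 'e::real_normed_vector) atlas \<Rightarrow> 'a conn \<Rightarrow> bool" where
  "torsion_free M nabla \<longleftrightarrow>
     (\<forall>X\<in>vfields M. \<forall>Y\<in>vfields M. nabla X Y - nabla Y X = lie_bracket X Y)"

text \<open>The connection \<open>\<sigma>\<cdot>\<nabla>\<close>.\<close>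

definition push_connection ::
    "('a, 'e::real_normed_vector) atlas \<Rightarrow> ('b, 'e) atlas \<Rightarrow> ('a \<Rightarrow> 'b) \<Rightarrow> 'a conn \<Rightarrow> 'b conn" where
  "push_connection M M1 \<sigma> nabla = (\<lambda>X Y. push_vfield M M1 \<sigma>
     (nabla (push_vfield M1 M (inv_into (points M) \<sigma>) X)
            (push_vfield M1 M (inv_into (points M) \<sigma>) Y)))"

section \<open>Symplectic manifolds and symplectic connections\<close>

type_synonym 'a form2 = "'a \<Rightarrow> 'a tvec \<Rightarrow> 'a tvec \<Rightarrow> real"

definition two_form :: "('a, 'e::real_normed_vector) atlas \<Rightarrow> 'a form2 \<Rightarrow> bool" where
  "two_form M \<omega> \<longleftrightarrow>
     (\<forall>p\<in>points M. \<forall>u\<in>tangent M p. \<forall>v\<in>tangent M p. \<forall>w\<in>tangent M p. \<forall>c.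
        \<omega> p (u + v) w = \<omega> p u w + \<omega> p v w \<and> \<omega> p (smul c u) w = c * \<omega> p u w \<and>
        \<omega> p u v = - \<omega> p v u) \<and>
     (\<forall>X\<in>vfields M. \<forall>Y\<in>vfields M. (\<lambda>p. \<omega> p (X p) (Y p)) \<in> Cinf M)"

definition ext_deriv :: "'a form2 \<Rightarrow> ('a \<Rightarrow> 'a tvec) \<Rightarrow> ('a \<Rightarrow> 'a tvec) \<Rightarrow> ('a \<Rightarrow> 'a tvec) \<Rightarrow> 'a \<Rightarrow> real"
  where
  "ext_deriv \<omega> X Y Z p =
       X p (\<lambda>q. \<omega> q (Y q) (Z q)) - Y p (\<lambda>q. \<omega> q (X q) (Z q)) + Z p (\<lambda>q. \<omega> q (X q) (Y q))
     - \<omega> p (lie_bracket X Y p) (Z p) + \<omega> p (lie_bracket X Z p) (Y p)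
     - \<omega> p (lie_bracket Y Z p) (X p)"

definition symplectic_manifold :: "('a, 'e::euclidean_space) atlas \<Rightarrow> 'a form2 \<Rightarrow> bool" where
  "symplectic_manifold M \<omega> \<longleftrightarrow> smooth_manifold M \<and> two_form M \<omega> \<and>
     (\<forall>X\<in>vfields M. \<forall>Y\<in>vfields M. \<forall>Z\<in>vfields M. \<forall>p\<in>points M. ext_deriv \<omega> X Y Z p = 0) \<and>
     (\<forall>p\<in>points M. \<forall>v\<in>tangent M p. (\<forall>w\<in>tangent M p. \<omega> p v w = 0) \<longrightarrow> v = 0)"

definition symplectomorphism ::
    "('a, 'e::real_normed_vector) atlas \<Rightarrow> 'a form2 \<Rightarrow> ('b, 'e) atlas \<Rightarrow> 'b form2 \<Rightarrow> ('a \<Rightarrow> 'b) \<Rightarrow> bool"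
  where
  "symplectomorphism M \<omega> M1 \<omega>1 \<sigma> \<longleftrightarrow> diffeomorphism M M1 \<sigma> \<and>
     (\<forall>p\<in>points M. \<forall>v\<in>tangent M p. \<forall>w\<in>tangent M p.
        \<omega>1 (\<sigma> p) (differential (Cinf M1) \<sigma> v) (differential (Cinf M1) \<sigma> w) = \<omega> p v w)"

definition symplectic_connection ::
    "('a, 'e::real_normed_vector) atlas \<Rightarrow> 'a form2 \<Rightarrow> 'a conn \<Rightarrow> bool" where
  "symplectic_connection M \<omega> nabla \<longleftrightarrow> linear_connection M nabla \<and> torsion_free M nabla \<and>
     (\<forall>X\<in>vfields M. \<forall>Y\<in>vfields M. \<forall>Z\<in>vfields M. \<forall>p\<in>points M.
        X p (\<lambda>q. \<omega> q (Y q) (Z q)) = \<omega> p (nabla X Y p) (Z p) + \<omega> p (Y p) (nabla X Z p))"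

section \<open>The twistor space\<close>

text \<open>Endomorphisms of a tangent space are extended by \<open>0\<close>, so that they are determined by their
  restriction to the tangent space.\<close>

definition tangent_End :: "('a, 'e::real_normed_vector) atlas \<Rightarrow> 'a \<Rightarrow> ('a tvec \<Rightarrow> 'a tvec) set" where
  "tangent_End M x = {j.
     (\<forall>v\<in>tangent M x. j v \<in> tangent M x) \<and> (\<forall>v. v \<notin> tangent M x \<longrightarrow> j v = 0) \<and>
     (\<forall>v\<in>tangent M x. \<forall>w\<in>tangent M x. j (v + w) = j v + j w) \<and>
     (\<forall>c. \<forall>v\<in>tangent M x. j (smul c v) = smul c (j v))}"

text \<open>The symmetric bilinear form \<open>g\<close> on the vector space \<open>T\<close> is nondegenerate of signature \<open>(r, s)\<close>
  (linear independence of \<open>e\<close> follows from pseudo-orthonormality).\<close>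

definition has_signature :: "'a tvec set \<Rightarrow> ('a tvec \<Rightarrow> 'a tvec \<Rightarrow> real) \<Rightarrow> nat \<Rightarrow> nat \<Rightarrow> bool" where
  "has_signature T g r s \<longleftrightarrow> (\<exists>e::nat \<Rightarrow> 'a tvec.
     (\<forall>i<r + s. e i \<in> T) \<and>
     (\<forall>v\<in>T. \<exists>c. v = (\<Sum>i<r + s. smul (c i) (e i))) \<and>
     (\<forall>i<r + s. \<forall>k<r + s. g (e i) (e k) = (if i = k then (if i < r then 1 else - 1) else 0)))"

text \<open>A point of the bundle \<open>End TM\<close> is a pair of a base point and an endomorphism of its tangent
  space, so that the bundle projection \<open>\<pi>\<close> is \<open>fst\<close>.\<close>

type_synonym 'a epoint = "'a \<times> ('a tvec \<Rightarrow> 'a tvec)"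

definition twistor_space ::
    "('a, 'e::real_normed_vector) atlas \<Rightarrow> 'a form2 \<Rightarrow> nat \<Rightarrow> nat \<Rightarrow> 'a epoint set" where
  "twistor_space M \<omega> n l = {(x, j). x \<in> points M \<and> j \<in> tangent_End M x \<and>
     (\<forall>v\<in>tangent M x. j (j v) = - v) \<and>
     (\<forall>v\<in>tangent M x. \<forall>w\<in>tangent M x. \<omega> x (j v) (j w) = \<omega> x v w) \<and>
     has_signature (tangent M x) (\<lambda>v w. \<omega> x v (j w)) (2 * n - 2 * l) (2 * l)}"

text \<open>The isomorphism of the model space with the tangent space at \<open>x\<close> given by the coordinate frame
  of a chart.\<close>

definition coord_vec ::
    "('a, 'e::real_normed_vector) atlas \<Rightarrow> ('a, 'e) chart \<Rightarrow> 'a \<Rightarrow> 'e \<Rightarrow> 'a tvec" where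
  "coord_vec M = (\<lambda>(U, \<phi>) x u f.
     if f \<in> Cinf M then frechet_derivative (f \<circ> inv_into U \<phi>) (at (\<phi> x)) u else 0)"

text \<open>The charts of the total space of \<open>End TM\<close> induced by those of \<open>M\<close>: an endomorphism is mapped to
  its matrix in the coordinate frame.\<close>

definition End_chart ::
    "('a, 'e::real_normed_vector) atlas \<Rightarrow> ('a, 'e) chart \<Rightarrow> ('a epoint, 'e \<times> ('e \<Rightarrow>\<^sub>L 'e)) chart" where
  "End_chart M c =
     ({(x, j). x \<in> fst c \<and> j \<in> tangent_End M x},
      \<lambda>(x, j). (snd c x, Blinfun (\<lambda>u. inv (coord_vec M c x) (j (coord_vec M c x u)))))"

definition End_atlas ::
    "('a, 'e::real_normed_vector) atlas \<Rightarrow> ('a epoint, 'e \<times> ('e \<Rightarrow>\<^sub>L 'e)) atlas" where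
  "End_atlas M = End_chart M ` M"

text \<open>Smooth functions on the twistor space, as an embedded submanifold of \<open>End TM\<close>.\<close>

definition twistor_funs ::
    "('a, 'e::real_normed_vector) atlas \<Rightarrow> 'a form2 \<Rightarrow> nat \<Rightarrow> nat \<Rightarrow> ('a epoint \<Rightarrow> real) set" where
  "twistor_funs M \<omega> n l = smooth_funs (End_atlas M) (twistor_space M \<omega> n l)"

section \<open>The pull-back connection and the almost complex structure\<close>

text \<open>Definite description with default value \<open>0\<close>. It is used below only for objects that exist
  uniquely, whenever the arguments are as in the mathematical definition.\<close>

definition the_unique :: "('a \<Rightarrow> bool) \<Rightarrow> 'a::zero" where
  "the_unique P = (if \<exists>!x. P x then THE x. P x else 0)"

text \<open>Smooth sections of \<open>E = \<pi>\<^sup>*TM\<close>.\<close>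

definition E_sections ::
    "('a, 'e::real_normed_vector) atlas \<Rightarrow> 'a form2 \<Rightarrow> nat \<Rightarrow> nat \<Rightarrow> ('a epoint \<Rightarrow> 'a tvec) set" where
  "E_sections M \<omega> n l = {s.
     (\<forall>j\<in>twistor_space M \<omega> n l. s j \<in> tangent M (fst j)) \<and>
     (\<forall>j. j \<notin> twistor_space M \<omega> n l \<longrightarrow> s j = 0) \<and>
     (\<forall>f\<in>Cinf M. (\<lambda>j. s j f) \<in> twistor_funs M \<omega> n l)}"

definition pullback_section ::
    "('a, 'e::real_normed_vector) atlas \<Rightarrow> 'a form2 \<Rightarrow> nat \<Rightarrow> nat \<Rightarrow> ('a \<Rightarrow> 'a tvec)
      \<Rightarrow> 'a epoint \<Rightarrow> 'a tvec" where
  "pullback_section M \<omega> n l Y = (\<lambda>j. if j \<in> twistor_space M \<omega> n l then Y (fst j) else 0)"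

text \<open>
  A connection \<open>D\<close> on \<open>E\<close> is written \<open>D j X s\<close> for the derivative at \<open>j\<close> of the section \<open>s\<close> in the
  direction of the tangent vector \<open>X\<close> at \<open>j\<close>. The pull-back \<open>\<pi>\<^sup>*\<nabla>\<close> is the unique connection on \<open>E\<close> with
  \<open>(\<pi>\<^sup>*\<nabla>)\<^sub>X (\<pi>\<^sup>*Y) = \<nabla>\<^bsub>d\<pi> X\<^esub> Y\<close>.
\<close>

type_synonym 'a econn = "'a epoint \<Rightarrow> 'a epoint tvec \<Rightarrow> ('a epoint \<Rightarrow> 'a tvec) \<Rightarrow> 'a tvec"

definition is_E_connection ::
    "('a, 'e::real_normed_vector) atlas \<Rightarrow> 'a form2 \<Rightarrow> nat \<Rightarrow> nat \<Rightarrow> 'a econn \<Rightarrow> bool" where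
  "is_E_connection M \<omega> n l D \<longleftrightarrow>
    (let Z = twistor_space M \<omega> n l; F = twistor_funs M \<omega> n l; \<Gamma> = E_sections M \<omega> n l in
     (\<forall>j X s. j \<in> Z \<and> X \<in> tangent_space F j \<and> s \<in> \<Gamma> \<longrightarrow> D j X s \<in> tangent M (fst j)) \<and>
     (\<forall>j X s. \<not> (j \<in> Z \<and> X \<in> tangent_space F j \<and> s \<in> \<Gamma>) \<longrightarrow> D j X s = 0) \<and>
     (\<forall>j\<in>Z. \<forall>X\<in>tangent_space F j. \<forall>s\<in>\<Gamma>.
        (\<forall>Y\<in>tangent_space F j. D j (X + Y) s = D j X s + D j Y s) \<and>
        (\<forall>c. D j (smul c X) s = smul c (D j X s)) \<and>
        (\<forall>t\<in>\<Gamma>. D j X (s + t) = D j X s + D j X t) \<and>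
        (\<forall>f\<in>F. D j X (fmul f s) = smul (X f) (s j) + smul (f j) (D j X s))) \<and>
     (\<forall>X\<in>vector_fields F Z. \<forall>s\<in>\<Gamma>. (\<lambda>j. D j (X j) s) \<in> \<Gamma>))"

definition is_pullback_connection ::
    "('a, 'e::real_normed_vector) atlas \<Rightarrow> 'a form2 \<Rightarrow> nat \<Rightarrow> nat \<Rightarrow> 'a conn \<Rightarrow> 'a econn \<Rightarrow> bool" where
  "is_pullback_connection M \<omega> n l nabla D \<longleftrightarrow> is_E_connection M \<omega> n l D \<and>
     (\<forall>j\<in>twistor_space M \<omega> n l. \<forall>X\<in>tangent_space (twistor_funs M \<omega> n l) j.
      \<forall>V\<in>vfields M. \<forall>Y\<in>vfields M. V (fst j) = differential (Cinf M) fst X \<longrightarrow>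
        D j X (pullback_section M \<omega> n l Y) = nabla V Y (fst j))"

definition pullback_connection ::
    "('a, 'e::real_normed_vector) atlas \<Rightarrow> 'a form2 \<Rightarrow> nat \<Rightarrow> nat \<Rightarrow> 'a conn \<Rightarrow> 'a econn" where
  "pullback_connection M \<omega> n l nabla = the_unique (is_pullback_connection M \<omega> n l nabla)"

text \<open>The tautological section \<open>\<Phi>\<close> of \<open>End E\<close>, extended by \<open>0\<close> so that \<open>\<Phi> s\<close> is again an element of
  \<open>E_sections\<close> for every section \<open>s\<close>.\<close>

definition tautological ::
    "('a, 'e::real_normed_vector) atlas \<Rightarrow> 'a form2 \<Rightarrow> nat \<Rightarrow> nat \<Rightarrow> 'a epoint
      \<Rightarrow> 'a tvec \<Rightarrow> 'a tvec" where
  "tautological M \<omega> n l j = (if j \<in> twistor_space M \<omega> n l then snd j else 0)"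

text \<open>The induced connection on \<open>End E\<close>: \<open>(D\<^sub>X \<Psi>) s = D\<^sub>X (\<Psi> s) - \<Psi> (D\<^sub>X s)\<close>.\<close>

definition induced_End ::
    "'a econn \<Rightarrow> 'a epoint \<Rightarrow> 'a epoint tvec \<Rightarrow> ('a epoint \<Rightarrow> 'a tvec \<Rightarrow> 'a tvec)
      \<Rightarrow> ('a epoint \<Rightarrow> 'a tvec) \<Rightarrow> 'a tvec" where
  "induced_End D j X \<Psi> s = D j X (\<lambda>k. \<Psi> k (s k)) - \<Psi> j (D j X s)"

definition horizontal_space ::
    "('a, 'e::real_normed_vector) atlas \<Rightarrow> 'a form2 \<Rightarrow> nat \<Rightarrow> nat \<Rightarrow> 'a conn \<Rightarrow> 'a epoint
      \<Rightarrow> 'a epoint tvec set" where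
  "horizontal_space M \<omega> n l nabla j = {X \<in> tangent_space (twistor_funs M \<omega> n l) j.
     \<forall>s\<in>E_sections M \<omega> n l.
       induced_End (pullback_connection M \<omega> n l nabla) j X (tautological M \<omega> n l) s = 0}"

definition vertical_space ::
    "('a, 'e::real_normed_vector) atlas \<Rightarrow> 'a form2 \<Rightarrow> nat \<Rightarrow> nat \<Rightarrow> 'a epoint
      \<Rightarrow> 'a epoint tvec set" where
  "vertical_space M \<omega> n l j =
     {X \<in> tangent_space (twistor_funs M \<omega> n l) j. differential (Cinf M) fst X = 0}"

text \<open>
  The endomorphism \<open>B\<close> corresponding to a vertical vector \<open>X\<close>: if \<open>X\<close> is the velocity at \<open>t = 0\<close> of a
  curve \<open>j\<^sub>t\<close> in the fibre over \<open>x\<close>, then \<open>B\<close> is the ordinary derivative of \<open>j\<^sub>t\<close> at \<open>t = 0\<close>, so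
  \<open>(B Y\<^sub>x) f\<close> is the derivative of \<open>(j\<^sub>t Y\<^sub>x) f\<close>, for vector fields \<open>Y\<close> and functions \<open>f\<close> on \<open>M\<close>.
\<close>

definition vertical_End ::
    "('a, 'e::real_normed_vector) atlas \<Rightarrow> 'a epoint \<Rightarrow> 'a epoint tvec \<Rightarrow> 'a tvec \<Rightarrow> 'a tvec" where
  "vertical_End M j X = the_unique (\<lambda>B. B \<in> tangent_End M (fst j) \<and>
     (\<forall>Y\<in>vfields M. \<forall>f\<in>Cinf M. B (Y (fst j)) f = X (\<lambda>k. snd k (Y (fst k)) f)))"

definition J_horizontal ::
    "('a, 'e::real_normed_vector) atlas \<Rightarrow> 'a form2 \<Rightarrow> nat \<Rightarrow> nat \<Rightarrow> 'a conn \<Rightarrow> 'a epoint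
      \<Rightarrow> 'a epoint tvec \<Rightarrow> 'a epoint tvec" where
  "J_horizontal M \<omega> n l nabla j X = the_unique (\<lambda>Y. Y \<in> horizontal_space M \<omega> n l nabla j \<and>
     differential (Cinf M) fst Y = snd j (differential (Cinf M) fst X))"

definition J_vertical ::
    "('a, 'e::real_normed_vector) atlas \<Rightarrow> 'a form2 \<Rightarrow> nat \<Rightarrow> nat \<Rightarrow> 'a epoint
      \<Rightarrow> 'a epoint tvec \<Rightarrow> 'a epoint tvec" where
  "J_vertical M \<omega> n l j X = the_unique (\<lambda>Y. Y \<in> vertical_space M \<omega> n l j \<and>
     vertical_End M j Y = snd j \<circ> vertical_End M j X)"

definition J_twistor ::
    "('a, 'e::real_normed_vector) atlas \<Rightarrow> 'a form2 \<Rightarrow> nat \<Rightarrow> nat \<Rightarrow> 'a conn \<Rightarrow> 'a epoint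
      \<Rightarrow> 'a epoint tvec \<Rightarrow> 'a epoint tvec" where
  "J_twistor M \<omega> n l nabla j X = the_unique (\<lambda>Y.
     \<exists>Xh\<in>horizontal_space M \<omega> n l nabla j. \<exists>Xv\<in>vertical_space M \<omega> n l j.
       X = Xh + Xv \<and> Y = J_horizontal M \<omega> n l nabla j Xh + J_vertical M \<omega> n l j Xv)"

section \<open>Pseudo-holomorphic maps\<close>

definition pseudo_holomorphic ::
    "('a, 'e::real_normed_vector) atlas \<Rightarrow> 'a set \<Rightarrow> ('a \<Rightarrow> 'a tvec \<Rightarrow> 'a tvec) \<Rightarrow>
     ('b, 'f::real_normed_vector) atlas \<Rightarrow> 'b set \<Rightarrow> ('b \<Rightarrow> 'b tvec \<Rightarrow> 'b tvec) \<Rightarrow> ('a \<Rightarrow> 'b) \<Rightarrow> bool"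
  where
  "pseudo_holomorphic A S J B T K f \<longleftrightarrow> smooth_map A S B T f \<and>
     (\<forall>p\<in>S. \<forall>X\<in>tangent_space (smooth_funs A S) p.
        differential (smooth_funs B T) f (J p X) = K (f p) (differential (smooth_funs B T) f X))"

text \<open>The map \<open>\<Sigma>(j) = d\<sigma> \<circ> j \<circ> d\<sigma>\<^sup>-\<^sup>1\<close>.\<close>

definition twistor_lift ::
    "('a, 'e::real_normed_vector) atlas \<Rightarrow> ('b, 'e) atlas \<Rightarrow> ('a \<Rightarrow> 'b) \<Rightarrow> 'a epoint \<Rightarrow> 'b epoint" where
  "twistor_lift M M1 \<sigma> = (\<lambda>(x, j). (\<sigma> x, \<lambda>w. if w \<in> tangent M1 (\<sigma> x)
     then differential (Cinf M1) \<sigma> (j (differential (Cinf M) (inv_into (points M) \<sigma>) w)) else 0))"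

end

theory Submission
  imports Defs
begin

text \<open>
  The theorem is an instance of transport of structure: the almost complex structure is built
  canonically from \<open>(M, \<omega>, \<nabla>)\<close>, and \<open>\<sigma>\<close> is an isomorphism of \<open>(M, \<omega>, \<nabla>)\<close> with
  \<open>(M\<^sub>1, \<omega>\<^sub>1, \<sigma>\<cdot>\<nabla>)\<close>. What has to be shown is that each ingredient is natural.

  The only analytic input is \<open>push_chart\<close>: by the chain rule the chart \<open>\<phi> \<circ> \<sigma>\<inverse>\<close> is compatible with
  the maximal atlas \<open>M\<^sub>1\<close>, hence belongs to it. So the charts of \<open>M\<close> and \<open>M\<^sub>1\<close> correspond to each
  other with equal coordinates, and therefore so do the coordinate frames and the induced charts of
  \<open>End TM\<close> and \<open>End TM\<^sub>1\<close> (\<open>End_chart_related\<close>). Consequently \<open>\<sigma>\<close> and its lift \<open>\<Sigma>\<close> to the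
  twistor spaces are isomorphisms of algebras of smooth functions (locale \<open>fun_iso\<close>), and everything
  defined in terms of these algebras can be transported without coordinates.

  The pull-back connection and the horizontal and vertical parts of the complex structure are given by
  definite descriptions with default value \<open>0\<close>. If a bijection that fixes \<open>0\<close> interchanges the
  solutions of two conditions, then it maps the described object of one to that of the other
  (\<open>the_unique_transport\<close>); neither existence nor uniqueness of the solution is needed. Since the
  assumptions are symmetric in \<open>M\<close> and \<open>M\<^sub>1\<close>, each such bijection is obtained by proving one
  implication and applying it to \<open>\<sigma>\<inverse>\<close> as well; this is what the lemmas
  \<open>flip\<close>, \<open>twistor_flip\<close> and \<open>conn_flip\<close> are for.
\<close>

section \<open>Calculus of smooth maps between Euclidean spaces\<close>

lemma frechet_derivative_cong_open:
  assumes "open S" "x \<in> S" "\<And>y. y \<in> S \<Longrightarrow> f y = g y"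
  shows "frechet_derivative f (at x) = frechet_derivative g (at x)"
proof -
  have "(f has_derivative D) (at x) \<longleftrightarrow> (g has_derivative D) (at x)" for D
    using assms by (metis has_derivative_transform_within_open)
  then show ?thesis
    by (simp add: frechet_derivative_def)
qed

lemma differentiable_cong_open:
  assumes "open S" "x \<in> S" "\<And>y. y \<in> S \<Longrightarrow> f y = g y" "f differentiable (at x)"
  shows "g differentiable (at x)"
  using assms by (meson differentiable_def has_derivative_transform_within_open)

lemma Ck_on_cong:
  assumes "open S" "\<And>x. x \<in> S \<Longrightarrow> f x = g x" "Ck_on k f S"
  shows "Ck_on k g S"
  using assms(2,3)
proof (induction k arbitrary: f g)
  case 0
  then show ?case
    by (metis Ck_on.simps(1) continuous_on_eq)
next
  case (Suc k)
  have "g differentiable (at x)" if "x \<in> S" for x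
    using Suc.prems that assms(1) differentiable_cong_open[of S x f g] by auto
  moreover have "Ck_on k (\<lambda>x. frechet_derivative g (at x) v) S" for v
  proof (rule Suc.IH)
    show "frechet_derivative f (at x) v = frechet_derivative g (at x) v" if "x \<in> S" for x
      using frechet_derivative_cong_open[OF assms(1) that, of f g] Suc.prems(1) by simp
    show "Ck_on k (\<lambda>x. frechet_derivative f (at x) v) S"
      using Suc.prems(2) by simp
  qed
  ultimately show ?case
    by simp
qed

lemma Ck_on_subset: "Ck_on k f S \<Longrightarrow> S' \<subseteq> S \<Longrightarrow> Ck_on k f S'"
  by (induction k arbitrary: f) (auto intro: continuous_on_subset)

lemma Ck_on_local:
  assumes "\<And>x. x \<in> S \<Longrightarrow> \<exists>W. open W \<and> x \<in> W \<and> Ck_on k f W"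
  shows "Ck_on k f S"
  using assms
proof (induction k arbitrary: f)
  case 0
  then show ?case
    by (auto intro!: continuous_at_imp_continuous_on simp: continuous_on_eq_continuous_at)
      (metis continuous_on_eq_continuous_at)
next
  case (Suc k)
  have "f differentiable (at x)" if "x \<in> S" for x
    using Suc.prems[OF that] by auto
  moreover have "Ck_on k (\<lambda>x. frechet_derivative f (at x) v) S" for v
    by (rule Suc.IH) (use Suc.prems in force)
  ultimately show ?case
    by simp
qed

lemma Ck_on_Suc_imp: "Ck_on (Suc k) f S \<Longrightarrow> Ck_on k f S"
proof (induction k arbitrary: f)
  case 0
  then show ?case
    by (auto intro!: continuous_at_imp_continuous_on differentiable_imp_continuous_within)
next
  case (Suc k)
  have "Ck_on k (\<lambda>x. frechet_derivative f (at x) v) S" for v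
    by (rule Suc.IH) (use Suc.prems in simp)
  then show ?case
    using Suc.prems by simp
qed

lemma Ck_on_SucI:
  assumes "open S" "\<And>x. x \<in> S \<Longrightarrow> (f has_derivative f' x) (at x)"
    and "\<And>v. Ck_on k (\<lambda>x. f' x v) S"
  shows "Ck_on (Suc k) f S"
proof -
  have D: "frechet_derivative f (at x) = f' x" if "x \<in> S" for x
    using frechet_derivative_at[OF assms(2)[OF that]] by simp
  have "Ck_on k (\<lambda>x. frechet_derivative f (at x) v) S" for v
    by (rule Ck_on_cong[OF assms(1) _ assms(3)[of v]]) (simp add: D)
  then show ?thesis
    using assms(2) by (auto simp: differentiable_def)
qed

lemma Ck_on_SucD:
  assumes "Ck_on (Suc k) f S"
  shows "x \<in> S \<Longrightarrow> (f has_derivative frechet_derivative f (at x)) (at x)"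
    and "Ck_on k (\<lambda>x. frechet_derivative f (at x) v) S"
  using assms by (auto simp: frechet_derivative_works)

lemma Ck_on_const: "open S \<Longrightarrow> Ck_on k (\<lambda>x. c) S"
proof (induction k arbitrary: c)
  case (Suc k)
  then show ?case
    by (intro Ck_on_SucI[where f' = "\<lambda>_ _. 0"]) auto
qed (simp add: continuous_on_const)

lemma Ck_on_ident: "open S \<Longrightarrow> Ck_on k (\<lambda>x. x) S"
proof (cases k)
  case (Suc m)
  assume "open S"
  then show ?thesis
    unfolding Suc by (intro Ck_on_SucI[where f' = "\<lambda>_ v. v"] Ck_on_const) auto
qed (simp add: continuous_on_id)

lemma Ck_on_add:
  assumes "open S" "Ck_on k f S" "Ck_on k g S"
  shows "Ck_on k (\<lambda>x. f x + g x) S"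
  using assms(2,3)
proof (induction k arbitrary: f g)
  case (Suc k)
  show ?case
    using has_derivative_add[OF Ck_on_SucD(1)[OF Suc.prems(1)] Ck_on_SucD(1)[OF Suc.prems(2)]]
      Suc.IH[OF Ck_on_SucD(2)[OF Suc.prems(1)] Ck_on_SucD(2)[OF Suc.prems(2)]]
    by (rule Ck_on_SucI[OF assms(1)])
qed (auto intro: continuous_intros)

lemma Ck_on_sum:
  assumes "open S" "\<And>i. i \<in> I \<Longrightarrow> Ck_on k (f i) S"
  shows "Ck_on k (\<lambda>x. \<Sum>i\<in>I. f i x) S"
  using assms by (induction I rule: infinite_finite_induct) (auto intro: Ck_on_const Ck_on_add)

lemma Ck_on_inner_const:
  assumes "open S" "Ck_on k f S"
  shows "Ck_on k (\<lambda>x. f x \<bullet> b) S"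
  using assms(2)
proof (induction k arbitrary: f)
  case (Suc k)
  show ?case
    using has_derivative_inner_left[OF Ck_on_SucD(1)[OF Suc.prems(1)]]
      Suc.IH[OF Ck_on_SucD(2)[OF Suc.prems(1)]]
    by (rule Ck_on_SucI[OF assms(1)])
qed (auto intro: continuous_intros)

lemma Ck_on_scaleR:
  assumes "open S" "Ck_on k f S" "Ck_on k g S"
  shows "Ck_on k (\<lambda>x. f x *\<^sub>R g x) S"
  using assms(2,3)
proof (induction k arbitrary: f g)
  case (Suc k)
  show ?case
  proof (rule Ck_on_SucI[OF assms(1)])
    show "((\<lambda>x. f x *\<^sub>R g x) has_derivative (\<lambda>v. f x *\<^sub>R frechet_derivative g (at x) v
        + frechet_derivative f (at x) v *\<^sub>R g x)) (at x)" if "x \<in> S" for x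
      by (rule has_derivative_scaleR[OF Ck_on_SucD(1)[OF Suc.prems(1) that]
            Ck_on_SucD(1)[OF Suc.prems(2) that]])
    show "Ck_on k (\<lambda>x. f x *\<^sub>R frechet_derivative g (at x) v
        + frechet_derivative f (at x) v *\<^sub>R g x) S" for v
      by (intro Ck_on_add assms(1) Suc.IH Ck_on_SucD(2)[OF Suc.prems(1)]
          Ck_on_SucD(2)[OF Suc.prems(2)] Ck_on_Suc_imp[OF Suc.prems(1)]
          Ck_on_Suc_imp[OF Suc.prems(2)])
  qed
qed (auto intro: continuous_intros)

text \<open>The derivative of a composition is expanded in an orthonormal basis, because \<^const>\<open>Ck_on\<close> speaks
  of the derivatives in constant directions only.\<close>

lemma Ck_on_compose:
  fixes f :: "'a::real_normed_vector \<Rightarrow> 'b::euclidean_space" and g :: "'b \<Rightarrow> 'c::real_normed_vector"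
  assumes "open S" "open T" "f ` S \<subseteq> T" "Ck_on k f S" "Ck_on k g T"
  shows "Ck_on k (g \<circ> f) S"
  using assms(4,5)
proof (induction k arbitrary: g)
  case 0
  then show ?case
    using assms(3) continuous_on_compose continuous_on_subset unfolding Ck_on.simps(1) by blast
next
  case (Suc k)
  let ?f' = "\<lambda>x. frechet_derivative f (at x)" and ?g' = "\<lambda>y. frechet_derivative g (at y)"
  show ?case
  proof (rule Ck_on_SucI[OF assms(1)])
    fix x assume x: "x \<in> S"
    then have fx: "f x \<in> T"
      using assms(3) by auto
    have "linear (?g' (f x))"
      using Ck_on_SucD(1)[OF Suc.prems(2) fx] has_derivative_linear by blast
    then have expand: "?g' (f x) w = (\<Sum>b\<in>Basis. (w \<bullet> b) *\<^sub>R ?g' (f x) b)" for w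
      using linear_sum[of "?g' (f x)" "\<lambda>b. (w \<bullet> b) *\<^sub>R b" Basis]
      by (simp add: euclidean_representation linear_scale)
    have "?g' (f x) \<circ> ?f' x = (\<lambda>v. \<Sum>b\<in>Basis. (?f' x v \<bullet> b) *\<^sub>R ?g' (f x) b)"
      by (intro ext, unfold o_apply, rule expand)
    then show "((g \<circ> f) has_derivative (\<lambda>v. \<Sum>b\<in>Basis. (?f' x v \<bullet> b) *\<^sub>R ?g' (f x) b)) (at x)"
      using diff_chain_at[OF Ck_on_SucD(1)[OF Suc.prems(1) x] Ck_on_SucD(1)[OF Suc.prems(2) fx]]
      by simp
  next
    fix v
    have "Ck_on k ((\<lambda>y. ?g' y b) \<circ> f) S" for b
      by (intro Suc.IH Ck_on_Suc_imp[OF Suc.prems(1)] Ck_on_SucD(2)[OF Suc.prems(2)])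
    then show "Ck_on k (\<lambda>x. \<Sum>b\<in>Basis. (?f' x v \<bullet> b) *\<^sub>R ?g' (f x) b) S"
      by (intro Ck_on_sum Ck_on_scaleR Ck_on_inner_const assms(1) Ck_on_SucD(2)[OF Suc.prems(1)])
        (simp add: o_def)
  qed
qed

lemma Cinf_on_compose:
  fixes f :: "'a::real_normed_vector \<Rightarrow> 'b::euclidean_space" and g :: "'b \<Rightarrow> 'c::real_normed_vector"
  assumes "open S" "open T" "f ` S \<subseteq> T" "Cinf_on f S" "Cinf_on g T"
  shows "Cinf_on (g \<circ> f) S"
  using assms Ck_on_compose unfolding Cinf_on_def by blast

lemma Cinf_on_subset: "Cinf_on f S \<Longrightarrow> S' \<subseteq> S \<Longrightarrow> Cinf_on f S'"
  unfolding Cinf_on_def using Ck_on_subset by blast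

lemma Cinf_on_cong:
  "open S \<Longrightarrow> (\<And>x. x \<in> S \<Longrightarrow> f x = g x) \<Longrightarrow> Cinf_on f S \<Longrightarrow> Cinf_on g S"
  unfolding Cinf_on_def using Ck_on_cong by blast

lemma Cinf_on_local:
  "(\<And>x. x \<in> S \<Longrightarrow> \<exists>W. open W \<and> x \<in> W \<and> Cinf_on f W) \<Longrightarrow> Cinf_on f S"
  unfolding Cinf_on_def by (meson Ck_on_local)

lemma Cinf_on_continuous: "Cinf_on f S \<Longrightarrow> continuous_on S f"
  unfolding Cinf_on_def by (metis Ck_on.simps(1))

section \<open>Charts and diffeomorphisms\<close>

lemma smooth_mapE:
  assumes "smooth_map A S B T f" "p \<in> S"
  obtains U \<phi> V \<psi> W g where "(U, \<phi>) \<in> A" "(V, \<psi>) \<in> B" "p \<in> U" "f p \<in> V" "open W" "\<phi> p \<in> W"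
    "Cinf_on g W" "\<And>q. q \<in> S \<inter> U \<Longrightarrow> \<phi> q \<in> W \<Longrightarrow> f q \<in> V \<and> \<psi> (f q) = g (\<phi> q)"
proof -
  have "\<exists>c\<in>A. \<exists>d\<in>B. \<exists>W g. p \<in> fst c \<and> f p \<in> fst d \<and> open W \<and> snd c p \<in> W \<and> Cinf_on g W \<and>
      (\<forall>q\<in>S \<inter> fst c. snd c q \<in> W \<longrightarrow> f q \<in> fst d \<and> snd d (f q) = g (snd c q))"
    using assms by (simp add: smooth_map_def split_beta)
  then obtain c d W g where "c \<in> A" "d \<in> B" "p \<in> fst c" "f p \<in> fst d" "open W" "snd c p \<in> W"
    "Cinf_on g W" "\<forall>q\<in>S \<inter> fst c. snd c q \<in> W \<longrightarrow> f q \<in> fst d \<and> snd d (f q) = g (snd c q)"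
    by blast
  then show thesis
    using that[of "fst c" "snd c" "fst d" "snd d" W g] by auto
qed

text \<open>The definition of \<^const>\<open>smooth_map\<close> provides suitable charts around each point; the coordinate
  expression in any pair of charts is smooth, too, on the open set where it is defined.\<close>

lemma smooth_map_in_charts:
  fixes M :: "('a, 'e::euclidean_space) atlas" and M1 :: "('b, 'f::euclidean_space) atlas"
  assumes MM: "smooth_manifold M" "smooth_manifold M1"
    and s: "smooth_map M (points M) M1 (points M1) s"
    and c: "(U, \<phi>) \<in> M" and d: "(V, \<psi>) \<in> M1"
  shows "open (\<phi> ` {x \<in> U. s x \<in> V})"
    and "Cinf_on (\<psi> \<circ> s \<circ> inv_into U \<phi>) (\<phi> ` {x \<in> U. s x \<in> V})"
proof -
  have M: "compatible_charts c d" "is_chart c" if "c \<in> M" "d \<in> M" for c d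
    using MM that by (simp_all add: smooth_manifold_def)
  have M1: "compatible_charts c d" "is_chart c" if "c \<in> M1" "d \<in> M1" for c d
    using MM that by (simp_all add: smooth_manifold_def)
  let ?D = "\<phi> ` {x \<in> U. s x \<in> V}"
  have inj: "inj_on \<phi> U"
    using M(2)[OF c c] by (simp add: is_chart_def)
  have *: "\<exists>W. open W \<and> z \<in> W \<and> W \<subseteq> ?D \<and> Cinf_on (\<psi> \<circ> s \<circ> inv_into U \<phi>) W"
    if z: "z \<in> ?D" for z
  proof -
    obtain p where p: "p \<in> U" "s p \<in> V" "z = \<phi> p"
      using z by auto
    have "p \<in> points M"
      using c p(1) by (force simp: points_def)
    then obtain U0 \<phi>0 V0 \<psi>0 W0 g where
      c0: "(U0, \<phi>0) \<in> M" and d0: "(V0, \<psi>0) \<in> M1" and p0: "p \<in> U0" "s p \<in> V0" "open W0" "\<phi>0 p \<in> W0"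
      and g: "Cinf_on g W0" and
      eq: "\<And>q. q \<in> points M \<inter> U0 \<Longrightarrow> \<phi>0 q \<in> W0 \<Longrightarrow> s q \<in> V0 \<and> \<psi>0 (s q) = g (\<phi>0 q)"
      by (rule smooth_mapE[OF s]) blast
    have inj0: "inj_on \<phi>0 U0" "inj_on \<psi>0 V0"
      using M(2)[OF c0 c0] M1(2)[OF d0 d0] by (simp_all add: is_chart_def)
    let ?a = "\<phi>0 \<circ> inv_into U \<phi>" and ?b = "\<psi> \<circ> inv_into V0 \<psi>0"
    have a: "open (\<phi> ` (U \<inter> U0))" "Cinf_on ?a (\<phi> ` (U \<inter> U0))"
      using M(1)[OF c c0] by (auto simp: compatible_charts_def)
    have b: "open (\<psi>0 ` (V0 \<inter> V))" "Cinf_on ?b (\<psi>0 ` (V0 \<inter> V))"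
      using M1(1)[OF d0 d] by (auto simp: compatible_charts_def)
    \<comment> \<open>Near \<open>z\<close> the given coordinate expression is \<open>?b \<circ> g \<circ> ?a\<close>, with transition maps \<open>?a\<close> and \<open>?b\<close>;
      \<open>W\<close> is the open set where this composition makes sense.\<close>
    define W1 where "W1 = \<phi> ` (U \<inter> U0) \<inter> ?a -` W0"
    define W where "W = W1 \<inter> (g \<circ> ?a) -` (\<psi>0 ` (V0 \<inter> V))"
    have W1: "open W1"
      unfolding W1_def
      by (rule continuous_open_preimage[OF Cinf_on_continuous[OF a(2)] a(1) p0(3)])
    have ga: "Cinf_on (g \<circ> ?a) W1"
      by (rule Cinf_on_compose[OF W1 p0(3) _ Cinf_on_subset[OF a(2)] g]) (auto simp: W1_def)
    have W: "open W"
      unfolding W_def by (rule continuous_open_preimage[OF Cinf_on_continuous[OF ga] W1 b(1)])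
    have bga: "Cinf_on (?b \<circ> (g \<circ> ?a)) W"
      by (rule Cinf_on_compose[OF W b(1) _ Cinf_on_subset[OF ga] b(2)]) (auto simp: W_def)
    have pts: "x \<in> points M" if "x \<in> U" for x
      using c that by (force simp: points_def)
    have "z \<in> W"
      using p p0 eq[of p] pts[OF p(1)] inj imageI[of "s p" "V0 \<inter> V" \<psi>0] by (auto simp: W_def W1_def)
    moreover have "w \<in> ?D \<and> (?b \<circ> (g \<circ> ?a)) w = (\<psi> \<circ> s \<circ> inv_into U \<phi>) w" if "w \<in> W" for w
    proof -
      obtain x where x: "x \<in> U" "x \<in> U0" "w = \<phi> x" "\<phi>0 x \<in> W0" "g (\<phi>0 x) \<in> \<psi>0 ` (V0 \<inter> V)"
        using \<open>w \<in> W\<close> inj by (auto simp: W_def W1_def)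
      then have sx: "s x \<in> V0" "\<psi>0 (s x) = g (\<phi>0 x)"
        using eq[of x] pts by auto
      have inv: "inv_into U \<phi> w = x" "inv_into V0 \<psi>0 (g (\<phi>0 x)) = s x"
        using inv_into_f_f[OF inj x(1)] inv_into_f_f[OF inj0(2) sx(1)] x(3) sx(2) by simp_all
      have "s x \<in> V"
        using x(5) inj0(2) sx by (metis IntD1 IntD2 imageE inj_onD)
      then show ?thesis
        using x(1,3) inv by auto
    qed
    then have "W \<subseteq> ?D" "Cinf_on (\<psi> \<circ> s \<circ> inv_into U \<phi>) W"
      using Cinf_on_cong[OF W _ bga] by blast+
    ultimately show ?thesis
      using W by blast
  qed
  show "open ?D"
    using * by (meson openI[of ?D] open_subopen)
  show "Cinf_on (\<psi> \<circ> s \<circ> inv_into U \<phi>) ?D"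
    using * by (meson Cinf_on_local)
qed

text \<open>Since the atlas of a smooth manifold is maximal, a diffeomorphism carries charts to charts.\<close>

lemma push_chart:
  fixes M :: "('a, 'e::euclidean_space) atlas" and M1 :: "('b, 'e) atlas"
  assumes M: "smooth_manifold M" and M1: "smooth_manifold M1"
    and s: "smooth_map M (points M) M1 (points M1) s"
    and t: "smooth_map M1 (points M1) M (points M) t"
    and ts: "\<And>x. x \<in> points M \<Longrightarrow> t (s x) = x" and st: "\<And>y. y \<in> points M1 \<Longrightarrow> s (t y) = y"
    and c: "(U, \<phi>) \<in> M"
  shows "(s ` U, \<phi> \<circ> t) \<in> M1"
proof -
  have pts: "x \<in> points M" if "x \<in> U" for x
    using c that by (force simp: points_def)
  have sT: "s x \<in> points M1" if "x \<in> U" for x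
    using s pts[OF that] by (auto simp: smooth_map_def)
  have inj: "inj_on \<phi> U" and opn: "open (\<phi> ` U)"
    using M c by (auto simp: smooth_manifold_def is_chart_def)
  have im: "(\<phi> \<circ> t) ` s ` A = \<phi> ` A" if "A \<subseteq> U" for A
    using ts pts that by (force simp: image_image image_iff)
  have inj': "inj_on (\<phi> \<circ> t) (s ` U)"
    using inj ts pts by (auto simp: inj_on_def)
  have inv: "inv_into (s ` U) (\<phi> \<circ> t) (\<phi> x) = s x" if "x \<in> U" for x
    using inv_into_f_f[OF inj', of "s x"] ts[OF pts[OF that]] that by simp
  have "compatible_charts (s ` U, \<phi> \<circ> t) d" if "d \<in> M1" for d
  proof -
    obtain V \<psi> where d: "d = (V, \<psi>)"
      by force
    then have dM: "(V, \<psi>) \<in> M1"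
      using that by simp
    have pts1: "y \<in> points M1" if "y \<in> V" for y
      using dM that by (force simp: points_def)
    have injd: "inj_on \<psi> V"
      using M1 dM by (auto simp: smooth_manifold_def is_chart_def)
    have a: "open (\<phi> ` {x \<in> U. s x \<in> V})"
        "Cinf_on (\<psi> \<circ> s \<circ> inv_into U \<phi>) (\<phi> ` {x \<in> U. s x \<in> V})"
      by (rule smooth_map_in_charts[OF M M1 s c dM])+
    have b: "open (\<psi> ` {y \<in> V. t y \<in> U})"
        "Cinf_on (\<phi> \<circ> t \<circ> inv_into V \<psi>) (\<psi> ` {y \<in> V. t y \<in> U})"
      by (rule smooth_map_in_charts[OF M1 M t dM c])+
    have e1: "s ` U \<inter> V = s ` {x \<in> U. s x \<in> V}" and e2: "s ` U \<inter> V = {y \<in> V. t y \<in> U}"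
      using ts pts st pts1 by (force simp: image_iff)+
    have e3: "(\<phi> \<circ> t) ` (s ` U \<inter> V) = \<phi> ` {x \<in> U. s x \<in> V}"
      unfolding e1 by (rule im) auto
    have "Cinf_on (\<psi> \<circ> inv_into (s ` U) (\<phi> \<circ> t)) (\<phi> ` {x \<in> U. s x \<in> V})"
      by (rule Cinf_on_cong[OF a(1) _ a(2)]) (auto simp: inv inj)
    then show ?thesis
      using a(1) b unfolding d compatible_charts_def split_conv e3 by (simp add: e2 comp_assoc)
  qed
  moreover have "is_chart (s ` U, \<phi> \<circ> t)"
    using inj' im[of U] opn by (simp add: is_chart_def)
  moreover have "fst (s ` U, \<phi> \<circ> t) \<subseteq> points M1"
    using sT by auto
  ultimately show ?thesis
    using M1 unfolding smooth_manifold_def by blast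
qed

lemma smooth_mapI:
  assumes "f ` S \<subseteq> T"
    and "\<And>p. p \<in> S \<Longrightarrow> \<exists>U \<phi> V \<psi> W g. (U, \<phi>) \<in> A \<and> (V, \<psi>) \<in> B \<and> p \<in> U \<and> f p \<in> V \<and> open W \<and>
      \<phi> p \<in> W \<and> Cinf_on g W \<and> (\<forall>q\<in>S \<inter> U. \<phi> q \<in> W \<longrightarrow> f q \<in> V \<and> \<psi> (f q) = g (\<phi> q))"
  shows "smooth_map A S B T f"
  unfolding smooth_map_def
proof (intro conjI ballI assms(1))
  fix p assume "p \<in> S"
  from assms(2)[OF this] obtain U \<phi> V \<psi> W g where
    "(U, \<phi>) \<in> A" "(V, \<psi>) \<in> B" "p \<in> U \<and> f p \<in> V \<and> open W \<and> \<phi> p \<in> W \<and> Cinf_on g W \<and>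
      (\<forall>q\<in>S \<inter> U. \<phi> q \<in> W \<longrightarrow> f q \<in> V \<and> \<psi> (f q) = g (\<phi> q))"
    by (elim exE conjE) (rule that, assumption+, intro conjI, assumption+)
  then show "\<exists>(U, \<phi>)\<in>A. \<exists>(V, \<psi>)\<in>B. \<exists>W g. p \<in> U \<and> f p \<in> V \<and> open W \<and> \<phi> p \<in> W \<and> Cinf_on g W \<and>
      (\<forall>q\<in>S \<inter> U. \<phi> q \<in> W \<longrightarrow> f q \<in> V \<and> \<psi> (f q) = g (\<phi> q))"
    unfolding split_beta
    by (intro bexI[of _ "(U, \<phi>)"] bexI[of _ "(V, \<psi>)"] exI[of _ W] exI[of _ g]) simp_all
qed

text \<open>The next two lemmas concern maps \<open>s\<close> such that charts of the two atlases correspond to each other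
  with equal coordinates, that is, maps that are the identity in suitable charts.\<close>

lemma smooth_map_precompose:
  assumes "s ` S \<subseteq> T"
    and charts: "\<And>d. d \<in> B \<Longrightarrow> \<exists>c\<in>A. \<forall>q\<in>S. (q \<in> fst c \<longleftrightarrow> s q \<in> fst d) \<and>
      (q \<in> fst c \<longrightarrow> snd c q = snd d (s q))"
    and g: "smooth_map B T C R g"
  shows "smooth_map A S C R (g \<circ> s)"
  unfolding smooth_map_def
proof (intro conjI ballI)
  show "(g \<circ> s) ` S \<subseteq> R"
    using assms(1) g by (auto simp: smooth_map_def)
  fix p assume p: "p \<in> S"
  then have "s p \<in> T"
    using assms(1) by auto
  then obtain V \<psi> V' \<psi>' W h where *: "(V, \<psi>) \<in> B" "(V', \<psi>') \<in> C" "s p \<in> V" "g (s p) \<in> V'" "open W"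
    "\<psi> (s p) \<in> W" "Cinf_on h W"
    "\<And>q. q \<in> T \<inter> V \<Longrightarrow> \<psi> q \<in> W \<Longrightarrow> g q \<in> V' \<and> \<psi>' (g q) = h (\<psi> q)"
    by (rule smooth_mapE[OF g]) blast
  obtain U \<phi> where c: "(U, \<phi>) \<in> A"
    "\<And>q. q \<in> S \<Longrightarrow> (q \<in> U \<longleftrightarrow> s q \<in> V) \<and> (q \<in> U \<longrightarrow> \<phi> q = \<psi> (s q))"
    using charts[OF *(1)] by auto
  have "\<forall>q\<in>S \<inter> U. \<phi> q \<in> W \<longrightarrow> (g \<circ> s) q \<in> V' \<and> \<psi>' ((g \<circ> s) q) = h (\<phi> q)"
    using c(2) *(8) assms(1) by auto
  moreover have "p \<in> U \<and> (g \<circ> s) p \<in> V' \<and> open W \<and> \<phi> p \<in> W \<and> Cinf_on h W"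
    using c(2)[OF p] * by auto
  ultimately show "\<exists>(U, \<phi>)\<in>A. \<exists>(V, \<psi>)\<in>C. \<exists>W h. p \<in> U \<and> (g \<circ> s) p \<in> V \<and> open W \<and> \<phi> p \<in> W \<and>
      Cinf_on h W \<and> (\<forall>q\<in>S \<inter> U. \<phi> q \<in> W \<longrightarrow> (g \<circ> s) q \<in> V \<and> \<psi> ((g \<circ> s) q) = h (\<phi> q))"
    using c(1) *(2) by blast
qed

lemma points_chart: "p \<in> points A \<longleftrightarrow> (\<exists>U \<phi>. (U, \<phi>) \<in> A \<and> p \<in> U)"
  by (auto simp: points_def) (metis fst_conv)

lemma chart_point: "(U, \<phi>) \<in> A \<Longrightarrow> p \<in> U \<Longrightarrow> p \<in> points A"
  by (auto simp: points_chart)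

lemma smooth_map_of_charts:
  assumes "S \<subseteq> points A" "s ` S \<subseteq> T"
    and charts: "\<And>c. c \<in> A \<Longrightarrow> \<exists>d\<in>B. \<forall>q\<in>S. (q \<in> fst c \<longleftrightarrow> s q \<in> fst d) \<and>
      (q \<in> fst c \<longrightarrow> snd c q = snd d (s q))"
  shows "smooth_map A S B T s"
  unfolding smooth_map_def
proof (intro conjI ballI)
  fix p assume p: "p \<in> S"
  then obtain U \<phi> where c: "(U, \<phi>) \<in> A" "p \<in> U"
    using assms(1) by (meson points_chart subsetD)
  obtain V \<psi> where d: "(V, \<psi>) \<in> B"
    "\<And>q. q \<in> S \<Longrightarrow> (q \<in> U \<longleftrightarrow> s q \<in> V) \<and> (q \<in> U \<longrightarrow> \<phi> q = \<psi> (s q))"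
    using charts[OF c(1)] by auto
  have "p \<in> U \<and> s p \<in> V \<and> open UNIV \<and> \<phi> p \<in> UNIV \<and> Cinf_on (\<lambda>x. x) UNIV \<and>
      (\<forall>q\<in>S \<inter> U. \<phi> q \<in> UNIV \<longrightarrow> s q \<in> V \<and> \<psi> (s q) = \<phi> q)"
    using d(2) p c(2) Ck_on_ident by (auto simp: Cinf_on_def)
  then show "\<exists>(U, \<phi>)\<in>A. \<exists>(V, \<psi>)\<in>B. \<exists>W h. p \<in> U \<and> s p \<in> V \<and> open W \<and> \<phi> p \<in> W \<and>
      Cinf_on h W \<and> (\<forall>q\<in>S \<inter> U. \<phi> q \<in> W \<longrightarrow> s q \<in> V \<and> \<psi> (s q) = h (\<phi> q))"
    using c(1) d(1) by blast
qed (rule assms(2))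

section \<open>Isomorphic function algebras\<close>

lemma differential_0 [simp]: "differential G s 0 = 0"
  by (auto simp: differential_def)

lemma differential_add: "differential G s (u + v) = differential G s u + differential G s v"
  by (auto simp: differential_def)

lemma differential_diff: "differential G s (u - v) = differential G s u - differential G s v"
  by (auto simp: differential_def)

lemma differential_uminus: "differential G s (- v) = - differential G s v"
  by (auto simp: differential_def)

lemma differential_smul: "differential G s (smul c v) = smul c (differential G s v)"
  by (auto simp: differential_def smul_def)

lemma differential_sum: "differential G s (\<Sum>i\<in>I. v i) = (\<Sum>i\<in>I. differential G s (v i))"
  by (induction I rule: infinite_finite_induct)
    (simp_all only: differential_add differential_0 sum.infinite sum.empty sum.insert not_False_eq_True)

lemma smul_0 [simp]: "smul c 0 = 0" "smul 0 v = 0"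
  by (auto simp: smul_def)

text \<open>Vectors that, like derivations, vanish outside of \<open>F\<close> and depend on the restriction of a function
  to \<open>S\<close> only.\<close>

definition local_vec :: "('a \<Rightarrow> real) set \<Rightarrow> 'a set \<Rightarrow> 'a tvec set" where
  "local_vec F S = {v. (\<forall>f. f \<notin> F \<longrightarrow> v f = 0) \<and> (\<forall>f f'. (\<forall>p\<in>S. f p = f' p) \<longrightarrow> v f = v f')}"

lemma local_vec_cong: "v \<in> local_vec F S \<Longrightarrow> (\<And>p. p \<in> S \<Longrightarrow> f p = f' p) \<Longrightarrow> v f = v f'"
  by (auto simp: local_vec_def)

lemma local_vec_outside: "v \<in> local_vec F S \<Longrightarrow> f \<notin> F \<Longrightarrow> v f = 0"
  by (auto simp: local_vec_def)

lemma local_vec_0 [simp]: "0 \<in> local_vec F S"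
  by (auto simp: local_vec_def)

lemma local_vec_add: "u \<in> local_vec F S \<Longrightarrow> v \<in> local_vec F S \<Longrightarrow> u + v \<in> local_vec F S"
  unfolding local_vec_def mem_Collect_eq plus_fun_apply by (metis add_0)

lemma local_vec_smul: "v \<in> local_vec F S \<Longrightarrow> smul c v \<in> local_vec F S"
  unfolding local_vec_def smul_def by auto

lemma zero_in_tangent [simp]: "0 \<in> tangent_space F p"
  by (auto simp: tangent_space_def)

lemma tangent_add: "u \<in> tangent_space F p \<Longrightarrow> v \<in> tangent_space F p \<Longrightarrow> u + v \<in> tangent_space F p"
  by (auto simp: tangent_space_def algebra_simps)

lemma tangent_smul: "v \<in> tangent_space F p \<Longrightarrow> smul c v \<in> tangent_space F p"
  by (auto simp: tangent_space_def smul_def algebra_simps)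

lemma tangent_const_0: "v \<in> tangent_space F p \<Longrightarrow> 0 \<in> F \<Longrightarrow> v (\<lambda>q. 0) = 0"
proof -
  assume v: "v \<in> tangent_space F p" and "0 \<in> F"
  then have "v (\<lambda>q. 0 * (0 :: 'a \<Rightarrow> real) q) = 0 * v 0"
    unfolding tangent_space_def by blast
  then show ?thesis
    by simp
qed

text \<open>The algebra \<open>F\<close> of functions on \<open>S\<close>, whose elements are extended arbitrarily. Closure under the
  algebra operations is not assumed, since it plays no role for the transport.\<close>

locale fun_alg =
  fixes F :: "('a \<Rightarrow> real) set" and S :: "'a set"
  assumes cong: "f \<in> F \<Longrightarrow> (\<And>p. p \<in> S \<Longrightarrow> f p = f' p) \<Longrightarrow> f' \<in> F"
    and zero: "0 \<in> F"
begin

lemma vanishing_in: "(\<And>p. p \<in> S \<Longrightarrow> f p = 0) \<Longrightarrow> f \<in> F"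
  using cong[OF zero, of f] by simp

lemma tangent_local:
  assumes v: "v \<in> tangent_space F p" and p: "p \<in> S"
  shows "v \<in> local_vec F S"
proof -
  have van: "v h = 0" if h: "\<And>q. q \<in> S \<Longrightarrow> h q = 0" for h
  proof -
    \<comment> \<open>\<open>h\<close> is its own product with the indicator function of the complement of \<open>S\<close>.\<close>
    define ind where "ind = (\<lambda>q. if q \<in> S then 0 else 1 :: real)"
    have "h = h * ind"
      using h by (auto simp: ind_def)
    moreover have "v (h * ind) = v h * ind p + h p * v ind"
      using v vanishing_in[of h] vanishing_in[of ind] h by (auto simp: tangent_space_def ind_def)
    ultimately show ?thesis
      using h[OF p] p by (simp add: ind_def)
  qed
  have "v f = v f'" if eq: "\<And>q. q \<in> S \<Longrightarrow> f q = f' q" for f f'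
  proof (cases "f \<in> F")
    case True
    have d: "f' - f \<in> F"
      using eq by (intro vanishing_in) simp
    have "v (f + (f' - f)) = v f + v (f' - f)"
      using v True d unfolding tangent_space_def by blast
    then show ?thesis
      using van[of "f' - f"] eq by simp
  next
    case False
    then have "f' \<notin> F"
      using cong[of f' f] eq by metis
    then show ?thesis
      using v False by (simp add: tangent_space_def)
  qed
  moreover have "v f = 0" if "f \<notin> F" for f
    using v that unfolding tangent_space_def by blast
  ultimately show ?thesis
    unfolding local_vec_def by blast
qed

lemma vfield_local: "X \<in> vector_fields F S \<Longrightarrow> X p \<in> local_vec F S"
  by (cases "p \<in> S") (auto simp: vector_fields_def intro: tangent_local)

end

lemma fun_alg_smooth_funs:
  assumes "S \<subseteq> points A"
  shows "fun_alg (smooth_funs A S) S"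
proof
  fix f f' :: "'a \<Rightarrow> real"
  assume f: "f \<in> smooth_funs A S" and eq: "\<And>p. p \<in> S \<Longrightarrow> f p = f' p"
  show "f' \<in> smooth_funs A S"
    unfolding smooth_funs_def mem_Collect_eq
  proof (rule smooth_mapI)
    fix p assume p: "p \<in> S"
    have "smooth_map A S {(UNIV, \<lambda>x. x)} UNIV f"
      using f by (simp add: smooth_funs_def)
    then obtain U \<phi> V \<psi> W g where "(U, \<phi>) \<in> A" "(V, \<psi>) \<in> {(UNIV, \<lambda>x::real. x)}" "p \<in> U"
      "f p \<in> V" "open W" "\<phi> p \<in> W" "Cinf_on g W"
      "\<And>q. q \<in> S \<inter> U \<Longrightarrow> \<phi> q \<in> W \<Longrightarrow> f q \<in> V \<and> \<psi> (f q) = g (\<phi> q)"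
      using p by (rule smooth_mapE) blast
    then show "\<exists>U \<phi> V \<psi> W g. (U, \<phi>) \<in> A \<and> (V, \<psi>) \<in> {(UNIV, \<lambda>x::real. x)} \<and> p \<in> U \<and> f' p \<in> V \<and>
        open W \<and> \<phi> p \<in> W \<and> Cinf_on g W \<and>
        (\<forall>q\<in>S \<inter> U. \<phi> q \<in> W \<longrightarrow> f' q \<in> V \<and> \<psi> (f' q) = g (\<phi> q))"
      using eq p by (intro exI[of _ U] exI[of _ \<phi>] exI[of _ V] exI[of _ \<psi>] exI[of _ W] exI[of _ g]) auto
  qed auto
next
  show "0 \<in> smooth_funs A S"
    unfolding smooth_funs_def mem_Collect_eq
  proof (rule smooth_mapI)
    fix p assume "p \<in> S"
    then obtain U \<phi> where "(U, \<phi>) \<in> A" "p \<in> U"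
      using assms by (meson points_chart subsetD)
    moreover have "Cinf_on (\<lambda>x. 0::real) UNIV"
      by (simp add: Cinf_on_def Ck_on_const)
    ultimately show "\<exists>U \<phi> V \<psi> W g. (U, \<phi>) \<in> A \<and> (V, \<psi>) \<in> {(UNIV, \<lambda>x::real. x)} \<and> p \<in> U \<and> 0 p \<in> V \<and>
        open W \<and> \<phi> p \<in> W \<and> Cinf_on g W \<and>
        (\<forall>q\<in>S \<inter> U. \<phi> q \<in> W \<longrightarrow> 0 q \<in> V \<and> \<psi> (0 q) = g (\<phi> q))"
      by (intro exI[of _ U] exI[of _ \<phi>] exI[of _ UNIV] exI[of _ "\<lambda>x. x"] exI[of _ "\<lambda>x. 0"]) auto
  qed auto
qed

text \<open>The push-forward of a vector field along \<open>s\<close> with inverse \<open>t\<close>, extended by \<open>0\<close> outside \<open>T\<close>. More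
  generally, the vectors may be attached to the points of another space that maps to the manifold;
  then \<open>t\<close> is the inverse of the bijection of these spaces. This is used for sections of the pull-back
  bundle \<open>E\<close>.\<close>

definition vf_push :: "('b \<Rightarrow> real) set \<Rightarrow> 'd set \<Rightarrow> ('a \<Rightarrow> 'b) \<Rightarrow> ('d \<Rightarrow> 'c)
    \<Rightarrow> ('c \<Rightarrow> 'a tvec) \<Rightarrow> 'd \<Rightarrow> 'b tvec" where
  "vf_push G T s t X = (\<lambda>y. if y \<in> T then differential G s (X (t y)) else 0)"

lemma vf_push_add: "vf_push G T s t (X + Y) = vf_push G T s t X + vf_push G T s t Y"
  and vf_push_diff: "vf_push G T s t (X - Y) = vf_push G T s t X - vf_push G T s t Y"
  and vf_push_fmul: "vf_push G T s t (fmul f X) = fmul (f \<circ> t) (vf_push G T s t X)"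
  by (auto simp: vf_push_def fmul_def fun_eq_iff differential_add differential_diff
      differential_smul)

lemma fmul_cong:
  "(\<And>p. p \<in> S \<Longrightarrow> f p = g p) \<Longrightarrow> (\<And>p. p \<notin> S \<Longrightarrow> X p = 0) \<Longrightarrow> fmul f X = fmul g X"
  unfolding fmul_def by (metis smul_0(1))

text \<open>An isomorphism \<open>s\<close> of the spaces \<open>(S, F)\<close> and \<open>(T, G)\<close>, with inverse \<open>t\<close>. Because the elements of
  \<open>F\<close> and \<open>G\<close> are extended arbitrarily, the two maps are inverse to each other on \<open>S\<close> and \<open>T\<close> only.\<close>

locale fun_iso = A: fun_alg F S + B: fun_alg G T
  for F :: "('a \<Rightarrow> real) set" and S :: "'a set" and G :: "('b \<Rightarrow> real) set" and T :: "'b set" +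
  fixes s :: "'a \<Rightarrow> 'b" and t :: "'b \<Rightarrow> 'a"
  assumes s_in: "x \<in> S \<Longrightarrow> s x \<in> T" and t_in: "y \<in> T \<Longrightarrow> t y \<in> S"
    and t_s: "x \<in> S \<Longrightarrow> t (s x) = x" and s_t: "y \<in> T \<Longrightarrow> s (t y) = y"
    and fun_pull: "g \<in> G \<Longrightarrow> g \<circ> s \<in> F" and fun_push: "f \<in> F \<Longrightarrow> f \<circ> t \<in> G"
begin

lemma flip: "fun_iso G T F S t s"
  by unfold_locales (auto intro: s_in t_in t_s s_t fun_pull fun_push)

lemma mem_iff: "g \<circ> s \<in> F \<longleftrightarrow> g \<in> G"
  using fun_pull fun_push[of "g \<circ> s"] B.cong[of "g \<circ> s \<circ> t" g] s_t by auto

lemma push_apply: "v \<in> local_vec F S \<Longrightarrow> differential G s v g = v (g \<circ> s)"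
  using mem_iff[of g] by (auto simp: differential_def local_vec_outside)

lemma push_local:
  assumes "v \<in> local_vec F S" shows "differential G s v \<in> local_vec G T"
  unfolding local_vec_def mem_Collect_eq
proof (intro conjI allI impI)
  fix f assume "f \<notin> G" then show "differential G s v f = 0"
    by (simp add: differential_def)
next
  fix f f' :: "'b \<Rightarrow> real" assume "\<forall>p\<in>T. f p = f' p"
  then show "differential G s v f = differential G s v f'"
    unfolding push_apply[OF assms] by (intro local_vec_cong[OF assms]) (auto intro: s_in)
qed

lemma pull_push:
  assumes "v \<in> local_vec F S" shows "differential F t (differential G s v) = v"
proof
  fix f
  have "differential F t (differential G s v) f = differential G s v (f \<circ> t)"
    by (rule fun_iso.push_apply[OF flip push_local[OF assms]])
  also have "\<dots> = v (f \<circ> t \<circ> s)"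
    by (rule push_apply[OF assms])
  also have "\<dots> = v f"
    by (rule local_vec_cong[OF assms]) (simp add: t_s)
  finally show "differential F t (differential G s v) f = v f" .
qed

lemma push_inject:
  "u \<in> local_vec F S \<Longrightarrow> v \<in> local_vec F S \<Longrightarrow> differential G s u = differential G s v \<longleftrightarrow> u = v"
  by (metis pull_push)

lemma push_tangent:
  assumes v: "v \<in> tangent_space F p" and p: "p \<in> S"
  shows "differential G s v \<in> tangent_space G (s p)"
proof -
  note v' = v[unfolded tangent_space_def mem_Collect_eq]
  have L: "differential G s v g = v (g \<circ> s)" for g
    by (rule push_apply[OF A.tangent_local[OF v p]])
  have comp: "(f + g) \<circ> s = (f \<circ> s) + (g \<circ> s)" "(f * g) \<circ> s = (f \<circ> s) * (g \<circ> s)"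
      "(\<lambda>q. c * f q) \<circ> s = (\<lambda>q. c * (f \<circ> s) q)" for f g :: "'b \<Rightarrow> real" and c
    by auto
  have out: "g \<notin> G \<Longrightarrow> v (g \<circ> s) = 0" for g
    using v' mem_iff[of g] by blast
  show ?thesis
    unfolding tangent_space_def mem_Collect_eq L comp
  proof (intro conjI ballI allI impI)
    fix f g c assume "f \<in> G" and "g \<in> G"
    then have fg: "f \<circ> s \<in> F" "g \<circ> s \<in> F"
      by (simp_all only: fun_pull)
    show "v ((f \<circ> s) + (g \<circ> s)) = v (f \<circ> s) + v (g \<circ> s)"
      using v' fg by blast
    have "v ((f \<circ> s) * (g \<circ> s)) = v (f \<circ> s) * (g \<circ> s) p + (f \<circ> s) p * v (g \<circ> s)"
      using v' fg by blast
    then show "v ((f \<circ> s) * (g \<circ> s)) = v (f \<circ> s) * g (s p) + f (s p) * v (g \<circ> s)"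
      by (simp only: o_apply)
  next
    fix c f assume "f \<in> G"
    then show "v (\<lambda>q. c * (f \<circ> s) q) = c * v (f \<circ> s)"
      using v' fun_pull by blast
  qed (rule out)
qed

lemma push_tangent_iff:
  assumes v: "v \<in> local_vec F S" and p: "p \<in> S"
  shows "differential G s v \<in> tangent_space G (s p) \<longleftrightarrow> v \<in> tangent_space F p"
  using push_tangent[OF _ p] fun_iso.push_tangent[OF flip _ s_in[OF p], of "differential G s v"]
    pull_push[OF v] t_s[OF p] by auto

abbreviation "push \<equiv> vf_push G T s t"
abbreviation "pull \<equiv> vf_push F S t s"

lemma push_vf:
  assumes X: "X \<in> vector_fields F S"
  shows "push X \<in> vector_fields G T"
proof -
  have "(\<lambda>y. push X y g) \<in> G" if g: "g \<in> G" for g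
  proof (rule B.cong)
    show "(\<lambda>p. X p (g \<circ> s)) \<circ> t \<in> G"
      using X fun_pull[OF g] by (intro fun_push) (auto simp: vector_fields_def)
    show "((\<lambda>p. X p (g \<circ> s)) \<circ> t) y = push X y g" if "y \<in> T" for y
      using that push_apply[OF A.vfield_local[OF X]] by (simp add: vf_push_def)
  qed
  moreover have "push X y \<in> tangent_space G y" if "y \<in> T" for y
    using X that push_tangent[of "X (t y)" "t y"] t_in[OF that] s_t[OF that]
    by (auto simp: vf_push_def vector_fields_def)
  ultimately show ?thesis
    by (auto simp: vector_fields_def vf_push_def)
qed

lemma pull_push_vf:
  assumes "\<And>p. p \<in> S \<Longrightarrow> X p \<in> local_vec F S" "\<And>p. p \<notin> S \<Longrightarrow> X p = 0"
  shows "pull (push X) = X"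
  using assms by (auto simp: vf_push_def fun_eq_iff s_in t_s pull_push)

lemma pull_push_vfield: "X \<in> vector_fields F S \<Longrightarrow> pull (push X) = X"
  by (rule pull_push_vf) (auto simp: A.vfield_local, auto simp: vector_fields_def)

lemma push_vf_at: "p \<in> S \<Longrightarrow> push X (s p) = differential G s (X p)"
  by (simp add: vf_push_def s_in t_s)

lemma push_fmul: "push (fmul (f \<circ> s) X) = fmul f (push X)"
  unfolding vf_push_fmul by (rule fmul_cong[of T]) (auto simp: s_t vf_push_def)

lemma push_vf_apply: "X \<in> vector_fields F S \<Longrightarrow> p \<in> S \<Longrightarrow> push X (s p) g = X p (g \<circ> s)"
  by (simp add: push_vf_at push_apply[OF A.vfield_local])

lemma push_bracket:
  assumes X: "X \<in> vector_fields F S" and Y: "Y \<in> vector_fields F S"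
  shows "push (lie_bracket X Y) = lie_bracket (push X) (push Y)"
proof (intro ext)
  have E: "push V y (\<lambda>q. push W q g) = V (t y) (\<lambda>p. W p (g \<circ> s))"
    if V: "V \<in> vector_fields F S" and W: "W \<in> vector_fields F S" and y: "y \<in> T" for V W y g
  proof -
    have "push V y (\<lambda>q. push W q g) = V (t y) ((\<lambda>q. push W q g) \<circ> s)"
      using y push_apply[OF A.vfield_local[OF V]] by (simp add: vf_push_def)
    also have "\<dots> = V (t y) (\<lambda>p. W p (g \<circ> s))"
      by (rule local_vec_cong[OF A.vfield_local[OF V]])
        (simp add: push_vf_at push_apply[OF A.vfield_local[OF W]])
    finally show ?thesis .
  qed
  \<comment> \<open>Iterated derivatives vanish outside \<open>F\<close>, as the push-forward does by definition outside \<open>G\<close>.\<close>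
  have Z: "V p (\<lambda>p. W p f) = 0"
    if V: "V \<in> vector_fields F S" and W: "W \<in> vector_fields F S" and f: "f \<notin> F" for V W p f
  proof -
    have "(\<lambda>p. W p f) = (\<lambda>p. 0)"
      using local_vec_outside[OF A.vfield_local[OF W] f] by simp
    moreover have "V p (\<lambda>p. 0) = 0"
      using V tangent_const_0[OF _ A.zero] by (cases "p \<in> S") (auto simp: vector_fields_def)
    ultimately show ?thesis
      by simp
  qed
  fix y g
  show "push (lie_bracket X Y) y g = lie_bracket (push X) (push Y) y g"
  proof (cases "y \<in> T")
    case True
    have "push (lie_bracket X Y) y g = (if g \<in> G then lie_bracket X Y (t y) (g \<circ> s) else 0)"
      using True by (simp add: vf_push_def differential_def)
    also have "\<dots> = lie_bracket X Y (t y) (g \<circ> s)"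
      using Z[OF X Y] Z[OF Y X] mem_iff[of g] by (auto simp: lie_bracket_def)
    finally show ?thesis
      using E X Y True by (simp add: lie_bracket_def)
  next
    case False
    then show ?thesis
      by (simp add: vf_push_def lie_bracket_def)
  qed
qed

end

section \<open>Transport of definite descriptions\<close>

lemma the_unique_transport:
  assumes "\<And>x. P x \<Longrightarrow> Q (h x) \<and> k (h x) = x" "\<And>y. Q y \<Longrightarrow> P (k y) \<and> h (k y) = y" "h 0 = 0"
  shows "the_unique Q = h (the_unique P)"
proof (cases "\<exists>!x. P x")
  case True
  then obtain x where x: "P x" "\<And>x'. P x' \<Longrightarrow> x' = x"
    by blast
  have "Q (h x)" "\<And>y. Q y \<Longrightarrow> y = h x"
    using assms x by metis+
  then have "\<exists>!y. Q y" "(THE y. Q y) = h x" "(THE x. P x) = x"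
    using x by (blast, blast, blast)
  then show ?thesis
    using True by (simp add: the_unique_def)
next
  case False
  then have "\<not> (\<exists>!y. Q y)"
    using assms by metis
  then show ?thesis
    using False assms(3) by (simp add: the_unique_def)
qed

lemma the_unique_cases: "P (the_unique P) \<or> the_unique P = 0"
  unfolding the_unique_def by (auto intro: theI')

section \<open>Isomorphic manifolds\<close>

lemma tangent_EndD:
  assumes "j \<in> tangent_End M x"
  shows "v \<in> tangent M x \<Longrightarrow> j v \<in> tangent M x" "v \<notin> tangent M x \<Longrightarrow> j v = 0"
    "v \<in> tangent M x \<Longrightarrow> w \<in> tangent M x \<Longrightarrow> j (v + w) = j v + j w"
    "v \<in> tangent M x \<Longrightarrow> j (smul c v) = smul c (j v)"
  using assms by (auto simp: tangent_End_def)

lemma tangent_End_at_0: "j \<in> tangent_End M x \<Longrightarrow> j 0 = 0"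
  using tangent_EndD(4)[of j M x 0 0] by simp

lemma coord_vec_local:
  assumes "(U, \<phi>) \<in> M" "is_chart (U, \<phi>)" "x \<in> U"
  shows "coord_vec M (U, \<phi>) x u \<in> local_vec (Cinf M) (points M)"
proof -
  interpret fun_alg "Cinf M" "points M"
    by (rule fun_alg_smooth_funs) simp
  have inj: "inj_on \<phi> U" "open (\<phi> ` U)"
    using assms by (auto simp: is_chart_def)
  have "coord_vec M (U, \<phi>) x u f = coord_vec M (U, \<phi>) x u f'"
    if eq: "\<forall>p\<in>points M. f p = f' p" for f f'
  proof -
    have "f \<in> Cinf M \<longleftrightarrow> f' \<in> Cinf M"
      using cong[of f f'] cong[of f' f] eq by auto
    \<comment> \<open>\<open>inv_into U \<phi>\<close> is arbitrary outside the open set \<open>\<phi> ` U\<close>, which does not affect the derivative.\<close>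
    moreover have "(f \<circ> inv_into U \<phi>) z = (f' \<circ> inv_into U \<phi>) z" if "z \<in> \<phi> ` U" for z
      using that inj(1) eq chart_point[OF assms(1)] by auto
    then have "frechet_derivative (f \<circ> inv_into U \<phi>) (at (\<phi> x))
        = frechet_derivative (f' \<circ> inv_into U \<phi>) (at (\<phi> x))"
      using assms(3) by (intro frechet_derivative_cong_open[OF inj(2)]) auto
    ultimately show ?thesis
      by (simp add: coord_vec_def)
  qed
  then show ?thesis
    unfolding local_vec_def by (simp add: coord_vec_def)
qed

text \<open>The endomorphism \<open>ds \<circ> j \<circ> dt\<close> of the tangent space at \<open>s x\<close>, for an endomorphism \<open>j\<close> of the
  tangent space at \<open>x\<close>.\<close>

definition End_conj ::
    "('a, 'e::real_normed_vector) atlas \<Rightarrow> ('b, 'e) atlas \<Rightarrow> ('a \<Rightarrow> 'b) \<Rightarrow> ('b \<Rightarrow> 'a)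
      \<Rightarrow> 'a \<Rightarrow> ('a tvec \<Rightarrow> 'a tvec) \<Rightarrow> 'b tvec \<Rightarrow> 'b tvec" where
  "End_conj M M1 s t x j = (\<lambda>w. if w \<in> tangent M1 (s x)
     then differential (Cinf M1) s (j (differential (Cinf M) t w)) else 0)"

text \<open>The induced map of the bundles of endomorphisms. The inverse \<open>t\<close> is an explicit argument, so that
  the lift of the inverse map is obtained by exchanging the roles of \<open>s\<close> and \<open>t\<close>.\<close>

definition End_lift ::
    "('a, 'e::real_normed_vector) atlas \<Rightarrow> ('b, 'e) atlas \<Rightarrow> ('a \<Rightarrow> 'b) \<Rightarrow> ('b \<Rightarrow> 'a)
      \<Rightarrow> 'a epoint \<Rightarrow> 'b epoint" where
  "End_lift M M1 s t k = (s (fst k), End_conj M M1 s t (fst k) (snd k))"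

text \<open>A diffeomorphism of manifolds, in the form in which it is used: it matches the charts of the two
  (maximal) atlases.\<close>

locale manifold_iso =
  fixes M :: "('a, 'e::euclidean_space) atlas" and M1 :: "('b, 'e) atlas"
    and s :: "'a \<Rightarrow> 'b" and t :: "'b \<Rightarrow> 'a"
  assumes point_in: "x \<in> points M \<Longrightarrow> s x \<in> points M1" "y \<in> points M1 \<Longrightarrow> t y \<in> points M"
    and point_inverse: "x \<in> points M \<Longrightarrow> t (s x) = x" "y \<in> points M1 \<Longrightarrow> s (t y) = y"
    and charts: "c \<in> M \<Longrightarrow> is_chart c" "d \<in> M1 \<Longrightarrow> is_chart d"
    and chart_push: "(U, \<phi>) \<in> M \<Longrightarrow> (s ` U, \<phi> \<circ> t) \<in> M1"
    and chart_pull: "(V, \<psi>) \<in> M1 \<Longrightarrow> (t ` V, \<psi> \<circ> s) \<in> M"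
begin

lemma flip: "manifold_iso M1 M t s"
  by unfold_locales (auto intro: point_in point_inverse charts chart_push chart_pull)

text \<open>Charts of \<open>M\<close> and \<open>M1\<close> with corresponding domains and equal coordinates. The coordinate maps need
  not agree outside the manifolds.\<close>

definition related :: "('a, 'e) chart \<Rightarrow> ('b, 'e) chart \<Rightarrow> bool" where
  "related c d \<longleftrightarrow> (\<forall>x\<in>points M. (x \<in> fst c \<longleftrightarrow> s x \<in> fst d) \<and> (x \<in> fst c \<longrightarrow> snd c x = snd d (s x)))"

lemma relatedD:
  assumes "related (U, \<phi>) (V, \<psi>)" "x \<in> points M"
  shows "x \<in> U \<longleftrightarrow> s x \<in> V" "x \<in> U \<Longrightarrow> \<psi> (s x) = \<phi> x"
  using assms by (auto simp: related_def)

lemma related_push: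
  assumes "c \<in> M" shows "\<exists>d\<in>M1. related c d"
proof -
  obtain U \<phi> where c: "c = (U, \<phi>)" by force
  have "x \<in> points M" if "x \<in> U" for x
    using chart_point[OF assms[unfolded c] that] .
  then have "related c (s ` U, \<phi> \<circ> t)"
    unfolding related_def c fst_conv snd_conv o_apply image_iff
    using point_inverse(1) by metis
  then show ?thesis
    using chart_push assms c by blast
qed

lemma related_pull:
  assumes "d \<in> M1" shows "\<exists>c\<in>M. related c d"
proof -
  obtain V \<psi> where d: "d = (V, \<psi>)" by force
  have "y \<in> points M1" if "y \<in> V" for y
    using chart_point[OF assms[unfolded d] that] .
  then have "related (t ` V, \<psi> \<circ> s) d"
    unfolding related_def d fst_conv snd_conv o_apply image_iff
    using point_inverse by metis
  then show ?thesis
    using chart_pull assms d by blast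
qed

lemma smooth_pull:
  assumes "g \<in> Cinf M1" shows "g \<circ> s \<in> Cinf M"
  using assms unfolding smooth_funs_def mem_Collect_eq
proof (rule smooth_map_precompose[rotated 2])
  show "s ` points M \<subseteq> points M1"
    using point_in by auto
  show "\<exists>c\<in>M. \<forall>q\<in>points M. (q \<in> fst c \<longleftrightarrow> s q \<in> fst d) \<and> (q \<in> fst c \<longrightarrow> snd c q = snd d (s q))"
    if "d \<in> M1" for d
    using related_pull[OF that] by (simp add: related_def)
qed

end

sublocale manifold_iso \<subseteq> base: fun_iso "Cinf M" "points M" "Cinf M1" "points M1" s t
proof -
  interpret A: fun_alg "Cinf M" "points M"
    by (rule fun_alg_smooth_funs) simp
  interpret B: fun_alg "Cinf M1" "points M1"
    by (rule fun_alg_smooth_funs) simp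
  show "fun_iso (Cinf M) (points M) (Cinf M1) (points M1) s t"
    by unfold_locales
      (auto intro: point_in point_inverse smooth_pull manifold_iso.smooth_pull[OF flip])
qed

context manifold_iso
begin

abbreviation "L \<equiv> differential (Cinf M1) s"
abbreviation "L' \<equiv> differential (Cinf M) t"
abbreviation "LV \<equiv> local_vec (Cinf M) (points M)"

lemma tangent_LV: "x \<in> points M \<Longrightarrow> v \<in> tangent M x \<Longrightarrow> v \<in> LV"
  by (rule base.A.tangent_local)

lemma push_tangent_surj:
  assumes x: "x \<in> points M" and w: "w \<in> tangent M1 (s x)"
  shows "\<exists>v\<in>tangent M x. w = L v"
proof (intro bexI)
  interpret F: fun_iso "Cinf M1" "points M1" "Cinf M" "points M" t s
    by (rule base.flip)
  have w': "w \<in> local_vec (Cinf M1) (points M1)"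
    by (rule base.B.tangent_local[OF w point_in(1)[OF x]])
  show "w = L (L' w)"
    using F.pull_push[OF w'] by simp
  show "L' w \<in> tangent M x"
    using F.push_tangent[OF w point_in(1)[OF x]] point_inverse(1)[OF x] by simp
qed

text \<open>This holds for all local vectors, because both sides vanish if \<open>v\<close> is not tangent. So the
  coordinate vectors \<^const>\<open>coord_vec\<close> need not be known to be derivations.\<close>

lemma End_conj_apply:
  assumes x: "x \<in> points M" and j: "j \<in> tangent_End M x" and v: "v \<in> LV"
  shows "End_conj M M1 s t x j (L v) = L (j v)"
proof (cases "v \<in> tangent M x")
  case True
  then show ?thesis
    using base.push_tangent[OF True x] base.pull_push[OF v] by (simp add: End_conj_def)
next
  case False
  then show ?thesis
    using base.push_tangent_iff[OF v x] tangent_EndD(2)[OF j False] by (simp add: End_conj_def)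
qed

lemma End_conj_in:
  assumes x: "x \<in> points M" and j: "j \<in> tangent_End M x"
  shows "End_conj M M1 s t x j \<in> tangent_End M1 (s x)"
proof -
  note app = End_conj_apply[OF x j tangent_LV[OF x]]
  have "End_conj M M1 s t x j w \<in> tangent M1 (s x)" if "w \<in> tangent M1 (s x)" for w
    using push_tangent_surj[OF x that] app tangent_EndD(1)[OF j] base.push_tangent[OF _ x] by auto
  moreover have "End_conj M M1 s t x j w = 0" if "w \<notin> tangent M1 (s x)" for w
    using that by (simp add: End_conj_def)
  moreover have "End_conj M M1 s t x j (w + w') = End_conj M M1 s t x j w + End_conj M M1 s t x j w'"
    if w: "w \<in> tangent M1 (s x)" "w' \<in> tangent M1 (s x)" for w w'
  proof -
    obtain v v' where v: "v \<in> tangent M x" "w = L v" "v' \<in> tangent M x" "w' = L v'"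
      using w push_tangent_surj[OF x] by blast
    have "L (v + v') = w + w'"
      by (simp only: v differential_add)
    then show ?thesis
      using app[OF tangent_add[OF v(1,3)]] app[OF v(1)] app[OF v(3)] tangent_EndD(3)[OF j v(1,3)]
      by (simp only: v differential_add)
  qed
  moreover have "End_conj M M1 s t x j (smul c w) = smul c (End_conj M M1 s t x j w)"
    if w: "w \<in> tangent M1 (s x)" for w c
  proof -
    obtain v where v: "v \<in> tangent M x" "w = L v"
      using w push_tangent_surj[OF x] by blast
    then show ?thesis
      using app[OF tangent_smul[OF v(1)]] app[OF v(1)] tangent_EndD(4)[OF j v(1)]
      by (simp only: v differential_smul)
  qed
  ultimately show ?thesis
    by (simp add: tangent_End_def)
qed

lemma End_conj_inverse:
  assumes x: "x \<in> points M" and j: "j \<in> tangent_End M x"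
  shows "End_conj M1 M t s (s x) (End_conj M M1 s t x j) = j"
proof
  fix v
  show "End_conj M1 M t s (s x) (End_conj M M1 s t x j) v = j v"
  proof (cases "v \<in> tangent M x")
    case True
    then have "j v \<in> LV"
      using tangent_EndD(1)[OF j] tangent_LV[OF x] by blast
    then show ?thesis
      using True base.pull_push[of "j v"] End_conj_apply[OF x j tangent_LV[OF x True]] point_inverse(1)[OF x]
      by (simp add: End_conj_def[of M1])
  next
    case False
    then show ?thesis
      using tangent_EndD(2)[OF j False] point_inverse(1)[OF x] by (simp add: End_conj_def[of M1])
  qed
qed

lemma coord_vec_push:
  assumes c: "(U, \<phi>) \<in> M" and d: "(V, \<psi>) \<in> M1" and r: "related (U, \<phi>) (V, \<psi>)" and x: "x \<in> U"
  shows "coord_vec M1 (V, \<psi>) (s x) u = L (coord_vec M (U, \<phi>) x u)"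
proof
  fix f :: "'b \<Rightarrow> real"
  have inj: "inj_on \<phi> U" "open (\<phi> ` U)" "inj_on \<psi> V"
    using charts(1)[OF c] charts(2)[OF d] by (auto simp: is_chart_def)
  have pt: "x \<in> points M" if "x \<in> U" for x
    using chart_point[OF c that] .
  have "frechet_derivative (f \<circ> inv_into V \<psi>) (at (\<phi> x))
      = frechet_derivative ((f \<circ> s) \<circ> inv_into U \<phi>) (at (\<phi> x))"
  proof (rule frechet_derivative_cong_open[OF inj(2)])
    fix z assume "z \<in> \<phi> ` U"
    then obtain q where q: "q \<in> U" "z = \<phi> q"
      by auto
    then have "s q \<in> V" "z = \<psi> (s q)"
      using relatedD[OF r pt[OF q(1)]] by auto
    then show "(f \<circ> inv_into V \<psi>) z = ((f \<circ> s) \<circ> inv_into U \<phi>) z"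
      using q inj by (metis comp_apply inv_into_f_f)
  qed (use x in auto)
  then show "coord_vec M1 (V, \<psi>) (s x) u f = L (coord_vec M (U, \<phi>) x u) f"
    using relatedD[OF r pt[OF x]] x base.mem_iff[of f] by (simp add: coord_vec_def differential_def)
qed

text \<open>The matrix of \<open>End_conj M M1 s t x j\<close> in the coordinate frame of a related chart is that of
  \<open>j\<close>.\<close>

lemma End_chart_related:
  assumes c: "(U, \<phi>) \<in> M" and d: "(V, \<psi>) \<in> M1" and r: "related (U, \<phi>) (V, \<psi>)"
    and x: "x \<in> points M" and j: "j \<in> tangent_End M x"
  shows "(x, j) \<in> fst (End_chart M (U, \<phi>)) \<longleftrightarrow> End_lift M M1 s t (x, j) \<in> fst (End_chart M1 (V, \<psi>))"
    and "(x, j) \<in> fst (End_chart M (U, \<phi>)) \<Longrightarrow>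
      snd (End_chart M (U, \<phi>)) (x, j) = snd (End_chart M1 (V, \<psi>)) (End_lift M M1 s t (x, j))"
proof -
  show "(x, j) \<in> fst (End_chart M (U, \<phi>)) \<longleftrightarrow> End_lift M M1 s t (x, j) \<in> fst (End_chart M1 (V, \<psi>))"
    using j End_conj_in[OF x j] relatedD(1)[OF r x] by (simp add: End_chart_def End_lift_def)
  assume "(x, j) \<in> fst (End_chart M (U, \<phi>))"
  then have xU: "x \<in> U"
    by (simp add: End_chart_def)
  let ?c = "coord_vec M (U, \<phi>) x"
  have loc: "?c u \<in> LV" for u
    by (rule coord_vec_local[OF c charts(1)[OF c] xU])
  have cp: "coord_vec M1 (V, \<psi>) (s x) = L \<circ> ?c"
    using coord_vec_push[OF c d r xU] by auto
  have "inv (L \<circ> ?c) (End_conj M M1 s t x j (L (?c u))) = inv ?c (j (?c u))" for u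
  proof -
    have "j (?c u) \<in> LV"
      using tangent_EndD(1,2)[OF j, of "?c u"] tangent_LV[OF x] by (cases "?c u \<in> tangent M x") auto
    then show ?thesis
      unfolding End_conj_apply[OF x j loc] inv_into_def by (simp add: base.push_inject[OF loc])
  qed
  then show "snd (End_chart M (U, \<phi>)) (x, j) = snd (End_chart M1 (V, \<psi>)) (End_lift M M1 s t (x, j))"
    using relatedD(2)[OF r x xU] by (simp add: End_chart_def End_lift_def cp)
qed

end

section \<open>The twistor spaces of isomorphic symplectic manifolds\<close>

lemma has_signature_image:
  assumes sig: "has_signature T g r q"
    and im: "\<And>v. v \<in> T \<Longrightarrow> h v \<in> T1" and surj: "\<And>w. w \<in> T1 \<Longrightarrow> \<exists>v\<in>T. w = h v"
    and sum: "\<And>c e. h (\<Sum>i<r + q. smul (c i) (e i)) = (\<Sum>i<r + q. smul (c i) (h (e i)))"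
    and form: "\<And>v w. v \<in> T \<Longrightarrow> w \<in> T \<Longrightarrow> g1 (h v) (h w) = g v w"
  shows "has_signature T1 g1 r q"
proof -
  obtain e where e: "\<forall>i<r + q. e i \<in> T" "\<forall>v\<in>T. \<exists>c. v = (\<Sum>i<r + q. smul (c i) (e i))"
    "\<forall>i<r + q. \<forall>k<r + q. g (e i) (e k) = (if i = k then (if i < r then 1 else - 1) else 0)"
    using sig by (auto simp: has_signature_def)
  have "\<exists>c. w = (\<Sum>i<r + q. smul (c i) (h (e i)))" if "w \<in> T1" for w
    using surj[OF that] e(2) sum by metis
  moreover have "\<forall>i<r + q. h (e i) \<in> T1"
    using e(1) im by blast
  moreover have "\<forall>i<r + q. \<forall>k<r + q. g1 (h (e i)) (h (e k)) =
      (if i = k then (if i < r then 1 else - 1) else 0)"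
    using e(1,3) form by simp
  ultimately show ?thesis
    unfolding has_signature_def by (intro exI[of _ "\<lambda>i. h (e i)"]) blast
qed

lemma twistor_spaceD:
  assumes "k \<in> twistor_space M \<omega> n l"
  shows "fst k \<in> points M" "snd k \<in> tangent_End M (fst k)"
  using assms by (auto simp: twistor_space_def)

text \<open>A symplectomorphism; \<open>n\<close> and \<open>l\<close> only select the twistor spaces.\<close>

locale twistor_iso = manifold_iso M M1 s t
  for M :: "('a, 'e::euclidean_space) atlas" and M1 :: "('b, 'e) atlas"
    and s :: "'a \<Rightarrow> 'b" and t :: "'b \<Rightarrow> 'a" +
  fixes \<omega> :: "'a form2" and \<omega>1 :: "'b form2" and n l :: nat
  assumes form_push: "p \<in> points M \<Longrightarrow> v \<in> tangent M p \<Longrightarrow> w \<in> tangent M p \<Longrightarrow>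
    \<omega>1 (s p) (differential (Cinf M1) s v) (differential (Cinf M1) s w) = \<omega> p v w"
begin

lemma twistor_flip: "twistor_iso M1 M t s \<omega>1 \<omega>"
proof -
  interpret F: manifold_iso M1 M t s
    by (rule flip)
  show ?thesis
  proof
    fix p v w assume p: "p \<in> points M1" and vw: "v \<in> tangent M1 p" "w \<in> tangent M1 p"
    show "\<omega> (t p) (L' v) (L' w) = \<omega>1 p v w"
      using form_push[OF point_in(2)[OF p], of "L' v" "L' w"] point_inverse(2)[OF p]
        F.base.push_tangent[OF _ p] F.base.pull_push F.tangent_LV[OF p] vw by simp
  qed
qed

abbreviation "Z \<equiv> twistor_space M \<omega> n l"
abbreviation "Z1 \<equiv> twistor_space M1 \<omega>1 n l"
abbreviation "\<Sigma> \<equiv> End_lift M M1 s t"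
abbreviation "\<Sigma>' \<equiv> End_lift M1 M t s"

lemma lift_in:
  assumes k: "k \<in> Z" shows "\<Sigma> k \<in> Z1"
proof -
  obtain x j where xj: "k = (x, j)" by force
  have x: "x \<in> points M" and j: "j \<in> tangent_End M x" and jj: "\<forall>v\<in>tangent M x. j (j v) = - v"
    and inv: "\<forall>v\<in>tangent M x. \<forall>w\<in>tangent M x. \<omega> x (j v) (j w) = \<omega> x v w"
    and sig: "has_signature (tangent M x) (\<lambda>v w. \<omega> x v (j w)) (2 * n - 2 * l) (2 * l)"
    using k by (auto simp: xj twistor_space_def)
  let ?j = "End_conj M M1 s t x j"
  have app: "?j (L v) = L (j v)" if "v \<in> tangent M x" for v
    by (rule End_conj_apply[OF x j tangent_LV[OF x that]])
  have jT: "j v \<in> tangent M x" if "v \<in> tangent M x" for v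
    using tangent_EndD(1)[OF j that] .
  have "?j (?j w) = - w" if "w \<in> tangent M1 (s x)" for w
    using push_tangent_surj[OF x that] app jT jj by (auto simp: differential_uminus)
  moreover have "\<omega>1 (s x) (?j w) (?j w') = \<omega>1 (s x) w w'"
    if w: "w \<in> tangent M1 (s x)" "w' \<in> tangent M1 (s x)" for w w'
  proof -
    obtain v v' where v: "v \<in> tangent M x" "w = L v" "v' \<in> tangent M x" "w' = L v'"
      using w push_tangent_surj[OF x] by blast
    then show ?thesis
      using form_push[OF x] app jT inv by simp
  qed
  moreover have "has_signature (tangent M1 (s x)) (\<lambda>v w. \<omega>1 (s x) v (?j w)) (2 * n - 2 * l) (2 * l)"
    using base.push_tangent[OF _ x] push_tangent_surj[OF x] form_push[OF x] app jT
    by (intro has_signature_image[OF sig, of L]) (auto simp only: differential_sum differential_smul)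
  ultimately show ?thesis
    using point_in(1)[OF x] End_conj_in[OF x j] by (simp add: xj End_lift_def twistor_space_def)
qed

lemma lift_inverse: "k \<in> Z \<Longrightarrow> \<Sigma>' (\<Sigma> k) = k"
  using twistor_spaceD[of k M \<omega> n l] End_conj_inverse point_inverse(1) by (simp add: End_lift_def)

lemma Z_covered: "Z \<subseteq> points (End_atlas M)"
proof
  fix k assume "k \<in> Z"
  then obtain U \<phi> where "(U, \<phi>) \<in> M" "fst k \<in> U" "snd k \<in> tangent_End M (fst k)"
    using twistor_spaceD[of k M \<omega> n l] by (meson points_chart)
  then have "k \<in> fst (End_chart M (U, \<phi>))"
    by (simp add: End_chart_def split_beta)
  moreover have "End_chart M (U, \<phi>) \<in> End_atlas M"
    unfolding End_atlas_def using \<open>(U, \<phi>) \<in> M\<close> by (rule imageI)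
  ultimately show "k \<in> points (End_atlas M)"
    by (auto simp: points_def)
qed

lemma End_chart_related':
  assumes "c \<in> M" "d \<in> M1" "related c d"
  shows "\<forall>q\<in>Z. (q \<in> fst (End_chart M c) \<longleftrightarrow> \<Sigma> q \<in> fst (End_chart M1 d)) \<and>
    (q \<in> fst (End_chart M c) \<longrightarrow> snd (End_chart M c) q = snd (End_chart M1 d) (\<Sigma> q))"
  using End_chart_related[of "fst c" "snd c" "fst d" "snd d"] assms twistor_spaceD
  by (metis prod.collapse)

lemma twistor_smooth_pull:
  assumes "g \<in> twistor_funs M1 \<omega>1 n l" shows "g \<circ> \<Sigma> \<in> twistor_funs M \<omega> n l"
  using assms unfolding twistor_funs_def smooth_funs_def mem_Collect_eq
proof (rule smooth_map_precompose[rotated 2])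
  show "\<Sigma> ` Z \<subseteq> Z1"
    using lift_in by auto
  fix d assume "d \<in> End_atlas M1"
  then obtain d' where d': "d' \<in> M1" "d = End_chart M1 d'"
    by (auto simp: End_atlas_def)
  then obtain c' where "c' \<in> M" "related c' d'"
    using related_pull by blast
  then show "\<exists>c\<in>End_atlas M. \<forall>q\<in>Z. (q \<in> fst c \<longleftrightarrow> \<Sigma> q \<in> fst d) \<and> (q \<in> fst c \<longrightarrow> snd c q = snd d (\<Sigma> q))"
    using End_chart_related'[of c' d'] d' by (auto simp: End_atlas_def)
qed

lemma lift_smooth: "smooth_map (End_atlas M) Z (End_atlas M1) Z1 \<Sigma>"
proof (rule smooth_map_of_charts[OF Z_covered])
  show "\<Sigma> ` Z \<subseteq> Z1"
    using lift_in by auto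
  fix c assume "c \<in> End_atlas M"
  then obtain c' where c': "c' \<in> M" "c = End_chart M c'"
    by (auto simp: End_atlas_def)
  then obtain d' where "d' \<in> M1" "related c' d'"
    using related_push by blast
  then show "\<exists>d\<in>End_atlas M1. \<forall>q\<in>Z. (q \<in> fst c \<longleftrightarrow> \<Sigma> q \<in> fst d) \<and> (q \<in> fst c \<longrightarrow> snd c q = snd d (\<Sigma> q))"
    using End_chart_related'[of c' d'] c' by (auto simp: End_atlas_def)
qed

end

sublocale twistor_iso \<subseteq> tw: fun_iso "twistor_funs M \<omega> n l" "twistor_space M \<omega> n l"
  "twistor_funs M1 \<omega>1 n l" "twistor_space M1 \<omega>1 n l" "End_lift M M1 s t" "End_lift M1 M t s"
proof -
  note F = twistor_iso.lift_in[OF twistor_flip] twistor_iso.lift_inverse[OF twistor_flip]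
    twistor_iso.twistor_smooth_pull[OF twistor_flip]
  interpret A: fun_alg "twistor_funs M \<omega> n l" "twistor_space M \<omega> n l"
    unfolding twistor_funs_def by (rule fun_alg_smooth_funs[OF Z_covered])
  interpret B: fun_alg "twistor_funs M1 \<omega>1 n l" "twistor_space M1 \<omega>1 n l"
    unfolding twistor_funs_def
    by (rule fun_alg_smooth_funs[OF twistor_iso.Z_covered[OF twistor_flip]])
  show "fun_iso (twistor_funs M \<omega> n l) (twistor_space M \<omega> n l)
      (twistor_funs M1 \<omega>1 n l) (twistor_space M1 \<omega>1 n l) (End_lift M M1 s t) (End_lift M1 M t s)"
    by unfold_locales (auto intro: lift_in lift_inverse twistor_smooth_pull F)
qed

section \<open>Transport of sections and connections of the pull-back bundle\<close>

text \<open>Points of \<open>End TM\<close> are pairs, but splitting quantified points into their components is never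
  useful below.\<close>

declare split_paired_All [simp del] split_paired_Ex [simp del]

text \<open>Sections of \<open>E\<close> that consist of local vectors; neither smoothness nor tangency is required. Unlike
  \<^const>\<open>E_sections\<close>, this class is closed under the operations below for trivial reasons.\<close>

definition local_section :: "('a, 'e::real_normed_vector) atlas \<Rightarrow> 'a form2 \<Rightarrow> nat \<Rightarrow> nat
    \<Rightarrow> ('a epoint \<Rightarrow> 'a tvec) set" where
  "local_section M \<omega> n l = {u. (\<forall>k. u k \<in> local_vec (Cinf M) (points M)) \<and>
     (\<forall>k. k \<notin> twistor_space M \<omega> n l \<longrightarrow> u k = 0)}"

text \<open>The transport of a connection on \<open>E\<close> along the isomorphism of twistor spaces, with the default
  value \<open>0\<close> that \<^const>\<open>is_E_connection\<close> prescribes.\<close>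

definition econn_push ::
    "('a, 'e::real_normed_vector) atlas \<Rightarrow> ('b, 'e) atlas \<Rightarrow> ('a \<Rightarrow> 'b) \<Rightarrow> ('b \<Rightarrow> 'a)
      \<Rightarrow> 'a form2 \<Rightarrow> 'b form2 \<Rightarrow> nat \<Rightarrow> nat \<Rightarrow> 'a econn \<Rightarrow> 'b econn" where
  "econn_push M M1 s t \<omega> \<omega>1 n l D = (\<lambda>k X u.
     if k \<in> twistor_space M1 \<omega>1 n l \<and> X \<in> tangent_space (twistor_funs M1 \<omega>1 n l) k \<and>
       u \<in> E_sections M1 \<omega>1 n l
     then differential (Cinf M1) s (D (End_lift M1 M t s k)
       (differential (twistor_funs M \<omega> n l) (End_lift M1 M t s) X)
       (vf_push (Cinf M) (twistor_space M \<omega> n l) t (End_lift M M1 s t) u))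
     else 0)"

lemma local_section_add:
  "u \<in> local_section M \<omega> n l \<Longrightarrow> v \<in> local_section M \<omega> n l \<Longrightarrow> u + v \<in> local_section M \<omega> n l"
  by (simp add: local_section_def local_vec_add)

lemma local_section_fmul: "u \<in> local_section M \<omega> n l \<Longrightarrow> fmul f u \<in> local_section M \<omega> n l"
  by (simp add: local_section_def local_vec_smul fmul_def)

lemma E_sections_local:
  assumes "u \<in> E_sections M \<omega> n l" shows "u \<in> local_section M \<omega> n l"
proof -
  interpret fun_alg "Cinf M" "points M"
    by (rule fun_alg_smooth_funs) simp
  have "u k \<in> local_vec (Cinf M) (points M)" for k
    using assms tangent_local[of "u k" "fst k"] twistor_spaceD(1)[of k M \<omega> n l]
    by (cases "k \<in> twistor_space M \<omega> n l") (auto simp: E_sections_def)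
  then show ?thesis
    using assms by (simp add: local_section_def E_sections_def)
qed

lemma is_E_connectionD:
  assumes "is_E_connection M \<omega> n l D"
  shows "j \<in> twistor_space M \<omega> n l \<Longrightarrow> X \<in> tangent_space (twistor_funs M \<omega> n l) j \<Longrightarrow>
      u \<in> E_sections M \<omega> n l \<Longrightarrow> D j X u \<in> tangent M (fst j)"
    and "\<not> (j \<in> twistor_space M \<omega> n l \<and> X \<in> tangent_space (twistor_funs M \<omega> n l) j \<and>
      u \<in> E_sections M \<omega> n l) \<Longrightarrow> D j X u = 0"
    and "j \<in> twistor_space M \<omega> n l \<Longrightarrow> X \<in> tangent_space (twistor_funs M \<omega> n l) j \<Longrightarrow>
      u \<in> E_sections M \<omega> n l \<Longrightarrow> Y \<in> tangent_space (twistor_funs M \<omega> n l) j \<Longrightarrow>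
      D j (X + Y) u = D j X u + D j Y u"
    and "j \<in> twistor_space M \<omega> n l \<Longrightarrow> X \<in> tangent_space (twistor_funs M \<omega> n l) j \<Longrightarrow>
      u \<in> E_sections M \<omega> n l \<Longrightarrow> D j (smul c X) u = smul c (D j X u)"
    and "j \<in> twistor_space M \<omega> n l \<Longrightarrow> X \<in> tangent_space (twistor_funs M \<omega> n l) j \<Longrightarrow>
      u \<in> E_sections M \<omega> n l \<Longrightarrow> v \<in> E_sections M \<omega> n l \<Longrightarrow> D j X (u + v) = D j X u + D j X v"
    and "j \<in> twistor_space M \<omega> n l \<Longrightarrow> X \<in> tangent_space (twistor_funs M \<omega> n l) j \<Longrightarrow>
      u \<in> E_sections M \<omega> n l \<Longrightarrow> f \<in> twistor_funs M \<omega> n l \<Longrightarrow>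
      D j X (fmul f u) = smul (X f) (u j) + smul (f j) (D j X u)"
    and "X' \<in> vector_fields (twistor_funs M \<omega> n l) (twistor_space M \<omega> n l) \<Longrightarrow>
      u \<in> E_sections M \<omega> n l \<Longrightarrow> (\<lambda>j. D j (X' j) u) \<in> E_sections M \<omega> n l"
  using assms unfolding is_E_connection_def Let_def by simp_all

context twistor_iso
begin

abbreviation "F \<equiv> twistor_funs M \<omega> n l"
abbreviation "F1 \<equiv> twistor_funs M1 \<omega>1 n l"
abbreviation "\<Gamma> \<equiv> E_sections M \<omega> n l"
abbreviation "\<Gamma>1 \<equiv> E_sections M1 \<omega>1 n l"
abbreviation "D\<Sigma> \<equiv> differential F1 \<Sigma>"
abbreviation "D\<Sigma>' \<equiv> differential F \<Sigma>'"
abbreviation "sec_push \<equiv> vf_push (Cinf M1) Z1 s \<Sigma>'"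
abbreviation "sec_pull \<equiv> vf_push (Cinf M) Z t \<Sigma>"
abbreviation "econn_p \<equiv> econn_push M M1 s t \<omega> \<omega>1 n l"

lemma fst_lift [simp]: "fst (\<Sigma> k) = s (fst k)"
  by (simp add: End_lift_def)

lemma snd_lift_apply: "k \<in> Z \<Longrightarrow> v \<in> LV \<Longrightarrow> snd (\<Sigma> k) (L v) = L (snd k v)"
  using End_conj_apply[of "fst k" "snd k" v] twistor_spaceD[of k M \<omega> n l] by (simp add: End_lift_def)

lemma snd_tangent: "k \<in> Z \<Longrightarrow> v \<in> tangent M (fst k) \<Longrightarrow> snd k v \<in> tangent M (fst k)"
  by (rule tangent_EndD(1)[OF twistor_spaceD(2)])

lemma tangent_Z_LV: "k \<in> Z \<Longrightarrow> v \<in> tangent M (fst k) \<Longrightarrow> v \<in> LV"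
  by (rule tangent_LV[OF twistor_spaceD(1)])

lemma sec_push_at: "k \<in> Z \<Longrightarrow> sec_push u (\<Sigma> k) = L (u k)"
  by (simp add: vf_push_def lift_in lift_inverse)

lemma local_sectionD: "u \<in> local_section M \<omega> n l \<Longrightarrow> u k \<in> LV"
  by (simp add: local_section_def)

lemma sec_pull_push:
  assumes "u \<in> local_section M \<omega> n l" shows "sec_pull (sec_push u) = u"
proof
  fix k
  show "sec_pull (sec_push u) k = u k"
    using base.pull_push[OF local_sectionD[OF assms]] sec_push_at[of k u] assms
    by (cases "k \<in> Z") (auto simp: vf_push_def[of "Cinf M"] local_section_def)
qed

lemma sec_push_in:
  assumes u: "u \<in> \<Gamma>" shows "sec_push u \<in> \<Gamma>1"
proof -
  note loc = local_sectionD[OF E_sections_local[OF u]]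
  have "sec_push u k \<in> tangent M1 (fst k)" if k: "k \<in> Z1" for k
  proof -
    have j: "\<Sigma>' k \<in> Z" "\<Sigma> (\<Sigma>' k) = k"
      using k tw.t_in tw.s_t by auto
    have "L (u (\<Sigma>' k)) \<in> tangent M1 (s (fst (\<Sigma>' k)))"
      using u j(1) twistor_spaceD(1)[OF j(1)] by (intro base.push_tangent) (auto simp: E_sections_def)
    then show ?thesis
      using k j(2) fst_lift[of "\<Sigma>' k"] by (simp add: vf_push_def)
  qed
  moreover have "(\<lambda>k. sec_push u k f) \<in> F1" if f: "f \<in> Cinf M1" for f
  proof (rule tw.B.cong)
    show "(\<lambda>k. u k (f \<circ> s)) \<circ> \<Sigma>' \<in> F1"
      using u smooth_pull[OF f] by (intro tw.fun_push) (auto simp: E_sections_def)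
    show "((\<lambda>k. u k (f \<circ> s)) \<circ> \<Sigma>') k = sec_push u k f" if "k \<in> Z1" for k
      using that base.push_apply[OF loc] by (simp add: vf_push_def)
  qed
  ultimately show ?thesis
    by (auto simp: E_sections_def vf_push_def)
qed

lemma sec_push_mem_iff:
  assumes "u \<in> local_section M \<omega> n l" shows "sec_push u \<in> \<Gamma>1 \<longleftrightarrow> u \<in> \<Gamma>"
proof
  assume "sec_push u \<in> \<Gamma>1"
  then have "sec_pull (sec_push u) \<in> \<Gamma>"
    by (rule twistor_iso.sec_push_in[OF twistor_flip])
  then show "u \<in> \<Gamma>"
    by (simp only: sec_pull_push[OF assms])
qed (rule sec_push_in)

lemma pullback_section_local:
  assumes "Y \<in> vfields M" shows "pullback_section M \<omega> n l Y \<in> local_section M \<omega> n l"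
  using base.A.vfield_local[OF assms] by (auto simp: local_section_def pullback_section_def)

lemma sec_push_pullback:
  "sec_push (pullback_section M \<omega> n l Y) = pullback_section M1 \<omega>1 n l (base.push Y)"
proof
  fix k
  show "sec_push (pullback_section M \<omega> n l Y) k = pullback_section M1 \<omega>1 n l (base.push Y) k"
  proof (cases "k \<in> Z1")
    case True
    then have j: "\<Sigma>' k \<in> Z" "\<Sigma> (\<Sigma>' k) = k"
      using tw.t_in tw.s_t by auto
    then show ?thesis
      using True base.push_vf_at[OF twistor_spaceD(1)[OF j(1)], of Y] fst_lift[of "\<Sigma>' k"]
      by (simp add: vf_push_def[of _ Z1] pullback_section_def)
  qed (simp add: vf_push_def pullback_section_def)
qed

lemma tangent_Z_local: "j \<in> Z \<Longrightarrow> X \<in> tangent_space F j \<Longrightarrow> X \<in> local_vec F Z"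
  by (rule tw.A.tangent_local)

lemma dfst_local:
  assumes X: "X \<in> local_vec F Z" shows "differential (Cinf M) fst X \<in> LV"
  unfolding local_vec_def mem_Collect_eq
proof (intro conjI allI impI)
  fix f f' :: "'a \<Rightarrow> real" assume eq: "\<forall>p\<in>points M. f p = f' p"
  then have "f \<in> Cinf M \<longleftrightarrow> f' \<in> Cinf M"
    using base.A.cong[of f f'] base.A.cong[of f' f] by auto
  moreover have "X (f \<circ> fst) = X (f' \<circ> fst)"
  proof (rule local_vec_cong[OF X])
    fix k assume "k \<in> Z"
    then show "(f \<circ> fst) k = (f' \<circ> fst) k"
      using eq twistor_spaceD(1)[of k M \<omega> n l] by simp
  qed
  ultimately show "differential (Cinf M) fst X f = differential (Cinf M) fst X f'"
    by (simp add: differential_def)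
qed (simp add: differential_def)

lemma dfst_push:
  assumes X: "X \<in> local_vec F Z"
  shows "differential (Cinf M1) fst (D\<Sigma> X) = L (differential (Cinf M) fst X)"
proof
  fix g :: "'b \<Rightarrow> real"
  have "(g \<circ> fst) \<circ> \<Sigma> = (g \<circ> s) \<circ> fst"
    by auto
  then show "differential (Cinf M1) fst (D\<Sigma> X) g = L (differential (Cinf M) fst X) g"
    using tw.push_apply[OF X, of "g \<circ> fst"] base.mem_iff[of g] by (simp add: differential_def[of "Cinf _"])
qed

text \<open>For a section that is not smooth both sides are \<open>0\<close>. Hence the equation can be applied to sums,
  products and images under \<open>\<Phi>\<close> of smooth sections without showing that these are smooth.\<close>

lemma econn_push_at:
  assumes D: "is_E_connection M \<omega> n l D \<or> D = 0"
    and j: "j \<in> Z" and X: "X \<in> tangent_space F j" and u: "u \<in> local_section M \<omega> n l"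
  shows "econn_p D (\<Sigma> j) (D\<Sigma> X) (sec_push u) = L (D j X u)"
proof -
  have "D\<Sigma> X \<in> tangent_space F1 (\<Sigma> j)"
    by (rule tw.push_tangent[OF X j])
  moreover have "D j X u = 0" if "u \<notin> \<Gamma>"
    using D is_E_connectionD(2)[of M \<omega> n l D j X u] that by auto
  ultimately show ?thesis
    using sec_push_mem_iff[OF u] lift_in[OF j] lift_inverse[OF j] tw.pull_push[OF tangent_Z_local[OF j X]]
      sec_pull_push[OF u] by (simp add: econn_push_def)
qed

lemma econn_push_inverse:
  assumes D: "is_E_connection M \<omega> n l D"
  shows "econn_push M1 M t s \<omega>1 \<omega> n l (econn_p D) = D"
proof -
  have "econn_push M1 M t s \<omega>1 \<omega> n l (econn_p D) j X u = D j X u" for j X u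
  proof (cases "j \<in> Z \<and> X \<in> tangent_space F j \<and> u \<in> \<Gamma>")
    case True
    then have "econn_push M1 M t s \<omega>1 \<omega> n l (econn_p D) j X u = L' (econn_p D (\<Sigma> j) (D\<Sigma> X) (sec_push u))"
      by (simp add: econn_push_def[of M1 M])
    also have "\<dots> = L' (L (D j X u))"
      using econn_push_at[OF disjI1[OF D], of j X u] True E_sections_local[of u M \<omega> n l] by simp
    also have "\<dots> = D j X u"
      using is_E_connectionD(1)[OF D, of j X u] True
      by (intro base.pull_push tangent_Z_LV[of j]) simp_all
    finally show ?thesis .
  next
    case False
    then show ?thesis
      using is_E_connectionD(2)[OF D False] by (auto simp: econn_push_def[of M1 M])
  qed
  then show ?thesis
    by (intro ext) simp
qed

lemma econn_push_is_E_connection: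
  assumes D: "is_E_connection M \<omega> n l D"
  shows "is_E_connection M1 \<omega>1 n l (econn_p D)"
proof -
  note DD = is_E_connectionD[OF D]
  have at: "\<exists>j X. j \<in> Z \<and> X \<in> tangent_space F j \<and> j1 = \<Sigma> j \<and> X1 = D\<Sigma> X"
    if "j1 \<in> Z1" "X1 \<in> tangent_space F1 j1" for j1 X1
  proof (intro exI conjI)
    interpret Fl: fun_iso F1 Z1 F Z \<Sigma>' \<Sigma>
      by (rule tw.flip)
    show "\<Sigma>' j1 \<in> Z" "j1 = \<Sigma> (\<Sigma>' j1)" "D\<Sigma>' X1 \<in> tangent_space F (\<Sigma>' j1)"
      using that tw.t_in tw.s_t Fl.push_tangent by auto
    show "X1 = D\<Sigma> (D\<Sigma>' X1)"
      using Fl.pull_push[OF tw.B.tangent_local[OF that(2,1)]] by simp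
  qed
  have sec: "\<exists>u\<in>\<Gamma>. u1 = sec_push u" if "u1 \<in> \<Gamma>1" for u1
    using twistor_iso.sec_push_in[OF twistor_flip that]
      twistor_iso.sec_pull_push[OF twistor_flip E_sections_local[OF that]] by metis
  note eq = econn_push_at[of D, OF disjI1[OF D]]
  note loc = E_sections_local[of _ M \<omega> n l]
  have 1: "econn_p D j1 X1 u1 \<in> tangent M1 (fst j1)"
    if i: "j1 \<in> Z1" "X1 \<in> tangent_space F1 j1" "u1 \<in> \<Gamma>1" for j1 X1 u1
  proof -
    obtain j X u where *: "j \<in> Z" "X \<in> tangent_space F j" "j1 = \<Sigma> j" "X1 = D\<Sigma> X" "u \<in> \<Gamma>" "u1 = sec_push u"
      using at[OF i(1,2)] sec[OF i(3)] by blast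
    then show ?thesis
      using eq[OF *(1,2) loc[OF *(5)]]
        base.push_tangent[OF DD(1)[OF *(1,2,5)] twistor_spaceD(1)[OF *(1)]] by simp
  qed
  have 2: "econn_p D j1 (X1 + Y1) u1 = econn_p D j1 X1 u1 + econn_p D j1 Y1 u1"
      "econn_p D j1 (smul c X1) u1 = smul c (econn_p D j1 X1 u1)"
      "econn_p D j1 X1 (u1 + v1) = econn_p D j1 X1 u1 + econn_p D j1 X1 v1"
      "f \<in> F1 \<Longrightarrow> econn_p D j1 X1 (fmul f u1) = smul (X1 f) (u1 j1) + smul (f j1) (econn_p D j1 X1 u1)"
    if j1: "j1 \<in> Z1" and X1: "X1 \<in> tangent_space F1 j1" and Y1: "Y1 \<in> tangent_space F1 j1"
      and u1: "u1 \<in> \<Gamma>1" and v1: "v1 \<in> \<Gamma>1"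
    for j1 X1 Y1 u1 v1 c f
  proof -
    obtain j X where *: "j \<in> Z" "X \<in> tangent_space F j" "j1 = \<Sigma> j" "X1 = D\<Sigma> X"
      using at[OF j1 X1] by blast
    have "\<exists>Y. Y \<in> tangent_space F j \<and> Y1 = D\<Sigma> Y"
      using at[OF j1 Y1] lift_inverse *(1,3) by metis
    then obtain Y where Y: "Y \<in> tangent_space F j" "Y1 = D\<Sigma> Y"
      by blast
    obtain u v where u: "u \<in> \<Gamma>" "u1 = sec_push u" and v: "v \<in> \<Gamma>" "v1 = sec_push v"
      using sec[OF u1] sec[OF v1] by blast
    show "econn_p D j1 (X1 + Y1) u1 = econn_p D j1 X1 u1 + econn_p D j1 Y1 u1"
      using eq[OF *(1) tangent_add[OF *(2) Y(1)] loc[OF u(1)]] eq[OF *(1,2) loc[OF u(1)]]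
        eq[OF *(1) Y(1) loc[OF u(1)]] DD(3)[OF *(1,2) u(1) Y(1)]
      by (simp only: *(3,4) Y(2) u(2) differential_add)
    show "econn_p D j1 (smul c X1) u1 = smul c (econn_p D j1 X1 u1)"
      using eq[OF *(1) tangent_smul[OF *(2)] loc[OF u(1)]] eq[OF *(1,2) loc[OF u(1)]]
        DD(4)[OF *(1,2) u(1)]
      by (simp only: *(3,4) u(2) differential_smul)
    show "econn_p D j1 X1 (u1 + v1) = econn_p D j1 X1 u1 + econn_p D j1 X1 v1"
      using eq[OF *(1,2) local_section_add[OF loc[OF u(1)] loc[OF v(1)]]] eq[OF *(1,2) loc[OF u(1)]]
        eq[OF *(1,2) loc[OF v(1)]] DD(5)[OF *(1,2) u(1) v(1)]
      by (simp only: *(3,4) u(2) v(2) vf_push_add differential_add)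
    show "econn_p D j1 X1 (fmul f u1) = smul (X1 f) (u1 j1) + smul (f j1) (econn_p D j1 X1 u1)"
      if f: "f \<in> F1"
    proof -
      have "fmul f u1 = sec_push (fmul (f \<circ> \<Sigma>) u)"
        unfolding u(2) vf_push_fmul by (rule fmul_cong[of Z1]) (auto simp: tw.s_t vf_push_def)
      then have "econn_p D j1 X1 (fmul f u1) = L (D j X (fmul (f \<circ> \<Sigma>) u))"
        using eq[OF *(1,2) local_section_fmul[OF loc[OF u(1)]]] by (simp add: *(3,4))
      also have "\<dots> = smul (X (f \<circ> \<Sigma>)) (L (u j)) + smul (f (\<Sigma> j)) (L (D j X u))"
        using DD(6)[OF *(1,2) u(1) tw.fun_pull[OF f]] by (simp only: differential_add differential_smul o_apply)
      also have "\<dots> = smul (X1 f) (u1 j1) + smul (f j1) (econn_p D j1 X1 u1)"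
        using eq[OF *(1,2) loc[OF u(1)]] tw.push_apply[OF tangent_Z_local[OF *(1,2)], of f]
          sec_push_at[OF *(1), of u] by (simp only: *(3,4) u(2))
      finally show ?thesis .
    qed
  qed
  have 3: "(\<lambda>j. econn_p D j (X1 j) u1) \<in> \<Gamma>1"
    if X1: "X1 \<in> vector_fields F1 Z1" and u1: "u1 \<in> \<Gamma>1" for X1 u1
  proof -
    interpret Fl: fun_iso F1 Z1 F Z \<Sigma>' \<Sigma>
      by (rule tw.flip)
    obtain u where u: "u \<in> \<Gamma>" "u1 = sec_push u"
      using sec[OF u1] by blast
    define X where "X = vf_push F Z \<Sigma>' \<Sigma> X1"
    have X: "X \<in> vector_fields F Z"
      unfolding X_def by (rule Fl.push_vf[OF X1])
    have "econn_p D k (X1 k) u1 = sec_push (\<lambda>j. D j (X j) u) k" for k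
    proof (cases "k \<in> Z1")
      case True
      let ?j = "\<Sigma>' k"
      have j: "?j \<in> Z" "\<Sigma> ?j = k"
        using True tw.t_in tw.s_t by auto
      have "X1 k = D\<Sigma> (X ?j)"
        using Fl.push_vf_at[OF True, of X1] Fl.pull_push[OF tw.B.vfield_local[OF X1], of k]
        by (simp add: X_def)
      moreover have "X ?j \<in> tangent_space F ?j"
        using X j(1) by (simp add: vector_fields_def)
      ultimately show ?thesis
        using eq[OF j(1) _ loc[OF u(1)], of "X ?j"] j u(2) True by (simp add: vf_push_def[of _ Z1 s \<Sigma>' "\<lambda>j. D j (X j) u"])
    qed (simp add: econn_push_def vf_push_def)
    then show ?thesis
      using sec_push_in[OF DD(7)[OF X u(1)]] by simp
  qed
  have 4: "econn_p D j1 X1 u1 = 0" if "\<not> (j1 \<in> Z1 \<and> X1 \<in> tangent_space F1 j1 \<and> u1 \<in> \<Gamma>1)" for j1 X1 u1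
    using that by (auto simp: econn_push_def)
  show ?thesis
    unfolding is_E_connection_def Let_def
    using 1 2 3 4 by (intro conjI allI impI ballI) blast+
qed

end

section \<open>The push-forward of a symplectic connection\<close>

context manifold_iso
begin

text \<open>The connection \<open>s\<cdot>\<nabla>\<close>.\<close>

abbreviation "conn_push nabla \<equiv> (\<lambda>X Y. base.push (nabla (base.pull X) (base.pull Y)))"

lemma pull_vf: "X \<in> vfields M1 \<Longrightarrow> base.pull X \<in> vfields M"
  by (rule fun_iso.push_vf[OF base.flip])

lemma push_pull_vf: "X \<in> vfields M1 \<Longrightarrow> base.push (base.pull X) = X"
  by (rule fun_iso.pull_push_vfield[OF base.flip])

lemma pull_apply: "X \<in> vfields M1 \<Longrightarrow> p \<in> points M \<Longrightarrow> base.pull X p (f \<circ> s) = X (s p) f"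
  using base.push_vf_apply[OF pull_vf, of X p f] push_pull_vf[of X] by simp

lemma linear_connection_push:
  assumes lin: "linear_connection M nabla"
  shows "linear_connection M1 (conn_push nabla)"
proof -
  note l = lin[unfolded linear_connection_def]
  have 1: "\<forall>X\<in>vfields M1. \<forall>Y\<in>vfields M1. conn_push nabla X Y \<in> vfields M1"
    using l pull_vf base.push_vf by blast
  have 2: "\<forall>X\<in>vfields M1. \<forall>X'\<in>vfields M1. \<forall>Y\<in>vfields M1.
      conn_push nabla (X + X') Y = conn_push nabla X Y + conn_push nabla X' Y"
  proof (intro ballI)
    fix X X' Y assume "X \<in> vfields M1" "X' \<in> vfields M1" "Y \<in> vfields M1"
    then have "nabla (base.pull X + base.pull X') (base.pull Y)
        = nabla (base.pull X) (base.pull Y) + nabla (base.pull X') (base.pull Y)"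
      using l pull_vf by blast
    then show "conn_push nabla (X + X') Y = conn_push nabla X Y + conn_push nabla X' Y"
      by (simp only: vf_push_add)
  qed
  have 3: "\<forall>X\<in>vfields M1. \<forall>Y\<in>vfields M1. \<forall>Y'\<in>vfields M1.
      conn_push nabla X (Y + Y') = conn_push nabla X Y + conn_push nabla X Y'"
  proof (intro ballI)
    fix X Y Y' assume "X \<in> vfields M1" "Y \<in> vfields M1" "Y' \<in> vfields M1"
    then have "nabla (base.pull X) (base.pull Y + base.pull Y')
        = nabla (base.pull X) (base.pull Y) + nabla (base.pull X) (base.pull Y')"
      using l pull_vf by blast
    then show "conn_push nabla X (Y + Y') = conn_push nabla X Y + conn_push nabla X Y'"
      by (simp only: vf_push_add)
  qed
  have 4: "\<forall>f\<in>Cinf M1. \<forall>X\<in>vfields M1. \<forall>Y\<in>vfields M1.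
      conn_push nabla (fmul f X) Y = fmul f (conn_push nabla X Y)"
  proof (intro ballI)
    fix f X Y assume "f \<in> Cinf M1" "X \<in> vfields M1" "Y \<in> vfields M1"
    then have "nabla (fmul (f \<circ> s) (base.pull X)) (base.pull Y)
        = fmul (f \<circ> s) (nabla (base.pull X) (base.pull Y))"
      using l pull_vf smooth_pull by blast
    then show "conn_push nabla (fmul f X) Y = fmul f (conn_push nabla X Y)"
      by (simp only: vf_push_fmul[of _ "points M"] base.push_fmul)
  qed
  have 5: "conn_push nabla X (fmul f Y) = fmul (\<lambda>p. X p f) Y + fmul f (conn_push nabla X Y)"
    if f: "f \<in> Cinf M1" and X: "X \<in> vfields M1" and Y: "Y \<in> vfields M1" for f X Y
  proof -
    let ?X = "base.pull X" and ?Y = "base.pull Y"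
    have "nabla ?X (base.pull (fmul f Y)) = fmul (\<lambda>p. ?X p (f \<circ> s)) ?Y + fmul (f \<circ> s) (nabla ?X ?Y)"
      using l pull_vf[OF X] pull_vf[OF Y] smooth_pull[OF f] by (simp only: vf_push_fmul[of _ "points M"])
    then have "conn_push nabla X (fmul f Y)
        = fmul ((\<lambda>p. ?X p (f \<circ> s)) \<circ> t) (base.push ?Y) + fmul f (conn_push nabla X Y)"
      by (simp only: vf_push_add base.push_fmul vf_push_fmul[of _ "points M1" s t "\<lambda>p. ?X p (f \<circ> s)"])
    moreover have "fmul ((\<lambda>p. ?X p (f \<circ> s)) \<circ> t) Y = fmul (\<lambda>p. X p f) Y"
    proof (rule fmul_cong[of "points M1"])
      fix p assume p: "p \<in> points M1"
      show "((\<lambda>p. ?X p (f \<circ> s)) \<circ> t) p = X p f"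
        using pull_apply[OF X point_in(2)[OF p]] point_inverse(2)[OF p] by simp
    qed (use Y in \<open>simp add: vector_fields_def\<close>)
    ultimately show ?thesis
      by (simp only: push_pull_vf[OF Y])
  qed
  show ?thesis
    unfolding linear_connection_def using 1 2 3 4 5 by (intro conjI ballI) blast+
qed

lemma torsion_free_push:
  assumes lin: "linear_connection M nabla" and tor: "torsion_free M nabla"
  shows "torsion_free M1 (conn_push nabla)"
  unfolding torsion_free_def
proof (intro ballI)
  fix X Y assume X: "X \<in> vfields M1" and Y: "Y \<in> vfields M1"
  let ?X = "base.pull X" and ?Y = "base.pull Y"
  have "nabla ?X ?Y - nabla ?Y ?X = lie_bracket ?X ?Y"
    using tor pull_vf[OF X] pull_vf[OF Y] by (simp add: torsion_free_def)
  then show "conn_push nabla X Y - conn_push nabla Y X = lie_bracket X Y"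
    using base.push_bracket[OF pull_vf[OF X] pull_vf[OF Y]]
    by (simp only: vf_push_diff[symmetric] push_pull_vf[OF X] push_pull_vf[OF Y])
qed

end

lemma (in twistor_iso) symplectic_connection_push:
  assumes sym: "symplectic_connection M \<omega> nabla"
  shows "symplectic_connection M1 \<omega>1 (conn_push nabla)"
proof -
  have lin: "linear_connection M nabla" and tor: "torsion_free M nabla"
    and par: "\<forall>X\<in>vfields M. \<forall>Y\<in>vfields M. \<forall>Z\<in>vfields M. \<forall>p\<in>points M.
      X p (\<lambda>q. \<omega> q (Y q) (Z q)) = \<omega> p (nabla X Y p) (Z p) + \<omega> p (Y p) (nabla X Z p)"
    using sym by (auto simp: symplectic_connection_def)
  have T: "X p \<in> tangent M p" if "X \<in> vfields M" "p \<in> points M" for X p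
    using that by (simp add: vector_fields_def)
  have "X p (\<lambda>q. \<omega>1 q (Y q) (W q)) = \<omega>1 p (conn_push nabla X Y p) (W p) + \<omega>1 p (Y p) (conn_push nabla X W p)"
    if X: "X \<in> vfields M1" and Y: "Y \<in> vfields M1" and W: "W \<in> vfields M1" and p: "p \<in> points M1"
    for X Y W p
  proof -
    let ?X = "base.pull X" and ?Y = "base.pull Y" and ?W = "base.pull W" and ?p = "t p"
    note v = pull_vf[OF X] pull_vf[OF Y] pull_vf[OF W]
    have q: "?p \<in> points M" "s ?p = p"
      using p point_in point_inverse by auto
    have at: "V (s x) = L (base.pull V x)" if "V \<in> vfields M1" "x \<in> points M" for V x
      using base.push_vf_at[OF that(2), of "base.pull V"] push_pull_vf[OF that(1)] by simp
    have n: "nabla ?X ?Y \<in> vfields M" "nabla ?X ?W \<in> vfields M"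
      using lin v by (auto simp: linear_connection_def)
    have "X p (\<lambda>q. \<omega>1 q (Y q) (W q)) = ?X ?p ((\<lambda>q. \<omega>1 q (Y q) (W q)) \<circ> s)"
      using pull_apply[OF X q(1)] q(2) by simp
    also have "\<dots> = ?X ?p (\<lambda>x. \<omega> x (?Y x) (?W x))"
      by (rule local_vec_cong[OF base.A.vfield_local[OF v(1)]])
        (simp add: at[OF Y] at[OF W] form_push T v)
    also have "\<dots> = \<omega> ?p (nabla ?X ?Y ?p) (?W ?p) + \<omega> ?p (?Y ?p) (nabla ?X ?W ?p)"
      using par v q(1) by blast
    also have "\<dots> = \<omega>1 p (conn_push nabla X Y p) (W p) + \<omega>1 p (Y p) (conn_push nabla X W p)"
      using form_push[OF q(1) T[OF n(1) q(1)] T[OF v(3) q(1)]]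
        form_push[OF q(1) T[OF v(2) q(1)] T[OF n(2) q(1)]]
        base.push_vf_at[OF q(1)] at[OF Y q(1)] at[OF W q(1)] q(2) by simp
    finally show ?thesis .
  qed
  then show ?thesis
    using linear_connection_push[OF lin] torsion_free_push[OF lin tor]
    by (simp add: symplectic_connection_def)
qed

section \<open>Transport of the almost complex structure\<close>

text \<open>A symplectomorphism that carries \<open>\<nabla>\<close> to \<open>\<nabla>\<^sup>1\<close>. The connections enter through their values on vector
  fields only.\<close>

locale twistor_conn_iso = twistor_iso M M1 s t \<omega> \<omega>1 n l
  for M :: "('a, 'e::euclidean_space) atlas" and M1 :: "('b, 'e) atlas"
    and s :: "'a \<Rightarrow> 'b" and t :: "'b \<Rightarrow> 'a" and \<omega> \<omega>1 n l +
  fixes nabla :: "'a conn" and nabla1 :: "'b conn"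
  assumes nabla_in: "X \<in> vfields M \<Longrightarrow> Y \<in> vfields M \<Longrightarrow> nabla X Y \<in> vfields M"
    and nabla_push: "X \<in> vfields M \<Longrightarrow> Y \<in> vfields M \<Longrightarrow>
      nabla1 (vf_push (Cinf M1) (points M1) s t X) (vf_push (Cinf M1) (points M1) s t Y)
      = vf_push (Cinf M1) (points M1) s t (nabla X Y)"
begin

lemma nabla1_eq:
  assumes "X \<in> vfields M1" "Y \<in> vfields M1"
  shows "nabla1 X Y = base.push (nabla (base.pull X) (base.pull Y))"
  using nabla_push[OF pull_vf pull_vf] assms push_pull_vf by simp

lemma conn_flip: "twistor_conn_iso M1 M t s \<omega>1 \<omega> nabla1 nabla"
proof -
  interpret Fl: twistor_iso M1 M t s \<omega>1 \<omega> n l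
    by (rule twistor_flip)
  show ?thesis
  proof
    fix X Y assume "X \<in> vfields M1" "Y \<in> vfields M1"
    then show "nabla1 X Y \<in> vfields M1" "nabla (base.pull X) (base.pull Y) = base.pull (nabla1 X Y)"
      using nabla1_eq[of X Y] nabla_in[OF pull_vf pull_vf] base.push_vf base.pull_push_vfield by simp_all
  qed
qed

lemma is_pullback_push:
  assumes D: "is_pullback_connection M \<omega> n l nabla D"
  shows "is_pullback_connection M1 \<omega>1 n l nabla1 (econn_p D)"
proof -
  have E: "is_E_connection M \<omega> n l D"
    using D by (simp add: is_pullback_connection_def)
  have "econn_p D k X (pullback_section M1 \<omega>1 n l Y) = nabla1 V Y (fst k)"
    if k: "k \<in> Z1" and X: "X \<in> tangent_space F1 k" and V: "V \<in> vfields M1" and Y: "Y \<in> vfields M1"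
      and eq: "V (fst k) = differential (Cinf M1) fst X" for k X V Y
  proof -
    interpret Fl: fun_iso F1 Z1 F Z \<Sigma>' \<Sigma>
      by (rule tw.flip)
    let ?j = "\<Sigma>' k" and ?X = "D\<Sigma>' X" and ?V = "base.pull V" and ?Y = "base.pull Y"
    have j: "?j \<in> Z" "\<Sigma> ?j = k"
      using k tw.t_in tw.s_t by auto
    have x: "fst ?j \<in> points M" "s (fst ?j) = fst k"
      using twistor_spaceD(1)[OF j(1)] fst_lift[of ?j] j(2) by auto
    have X': "?X \<in> tangent_space F ?j" "D\<Sigma> ?X = X"
      using Fl.push_tangent[OF X k] Fl.pull_push[OF tw.B.tangent_local[OF X k]] by auto
    note loc = tangent_Z_local[OF j(1) X'(1)]
    have "L (?V (fst ?j)) = L (differential (Cinf M) fst ?X)"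
      using dfst_push[OF loc] base.push_vf_at[OF x(1), of ?V] push_pull_vf[OF V] eq x(2) X'(2) by simp
    then have "?V (fst ?j) = differential (Cinf M) fst ?X"
      using base.push_inject[OF base.A.vfield_local[OF pull_vf[OF V]] dfst_local[OF loc]] by simp
    then have "D ?j ?X (pullback_section M \<omega> n l ?Y) = nabla ?V ?Y (fst ?j)"
      using D j(1) X'(1) pull_vf V Y unfolding is_pullback_connection_def by blast
    moreover have "econn_p D k X (pullback_section M1 \<omega>1 n l Y)
        = L (D ?j ?X (pullback_section M \<omega> n l ?Y))"
      using econn_push_at[OF disjI1[OF E] j(1) X'(1) pullback_section_local[OF pull_vf[OF Y]]]
      by (simp only: j(2) X'(2) sec_push_pullback push_pull_vf[OF Y])
    ultimately show ?thesis
      using base.push_vf_at[OF x(1), of "nabla ?V ?Y"] nabla1_eq[OF V Y] x(2) by simp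
  qed
  then show ?thesis
    unfolding is_pullback_connection_def using econn_push_is_E_connection[OF E] by blast
qed

abbreviation "pbc \<equiv> pullback_connection M \<omega> n l nabla"
abbreviation "pbc1 \<equiv> pullback_connection M1 \<omega>1 n l nabla1"

lemma pullback_connection_push: "pbc1 = econn_p pbc"
  unfolding pullback_connection_def
proof (rule the_unique_transport[where h = econn_p and k = "econn_push M1 M t s \<omega>1 \<omega> n l"])
  show "is_pullback_connection M1 \<omega>1 n l nabla1 (econn_p D) \<and>
      econn_push M1 M t s \<omega>1 \<omega> n l (econn_p D) = D" if "is_pullback_connection M \<omega> n l nabla D" for D
    using is_pullback_push[OF that] econn_push_inverse that by (simp add: is_pullback_connection_def)
  show "is_pullback_connection M \<omega> n l nabla (econn_push M1 M t s \<omega>1 \<omega> n l D) \<and>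
      econn_p (econn_push M1 M t s \<omega>1 \<omega> n l D) = D" if "is_pullback_connection M1 \<omega>1 n l nabla1 D" for D
    using twistor_conn_iso.is_pullback_push[OF conn_flip that]
      twistor_iso.econn_push_inverse[OF twistor_flip] that by (simp add: is_pullback_connection_def)
  show "econn_p 0 = 0"
    by (auto simp: econn_push_def fun_eq_iff differential_def)
qed

lemma pbc_cases: "is_E_connection M \<omega> n l pbc \<or> pbc = 0"
  using the_unique_cases[of "is_pullback_connection M \<omega> n l nabla"]
  unfolding pullback_connection_def is_pullback_connection_def by blast

text \<open>\<open>(\<pi>\<^sup>*\<nabla>)\<Phi>\<close> is equivariant because the tautological sections correspond to each other under
  \<open>\<Sigma>\<close>.\<close>

lemma horizontal_push:
  assumes j: "j \<in> Z" and X: "X \<in> horizontal_space M \<omega> n l nabla j"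
  shows "D\<Sigma> X \<in> horizontal_space M1 \<omega>1 n l nabla1 (\<Sigma> j)"
proof -
  have XT: "X \<in> tangent_space F j"
    and hor: "\<And>u. u \<in> \<Gamma> \<Longrightarrow> induced_End pbc j X (tautological M \<omega> n l) u = 0"
    using X by (auto simp: horizontal_space_def)
  have "induced_End pbc1 (\<Sigma> j) (D\<Sigma> X) (tautological M1 \<omega>1 n l) u1 = 0" if u1: "u1 \<in> \<Gamma>1" for u1
  proof -
    define u where "u = sec_pull u1"
    have u: "u \<in> \<Gamma>" "sec_push u = u1"
      using twistor_iso.sec_push_in[OF twistor_flip u1]
        twistor_iso.sec_pull_push[OF twistor_flip E_sections_local[OF u1]] by (simp_all add: u_def)
    let ?\<Phi>u = "\<lambda>k. tautological M \<omega> n l k (u k)"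
    have uT: "u k \<in> tangent M (fst k)" if "k \<in> Z" for k
      using u(1) that by (simp add: E_sections_def)
    have loc: "?\<Phi>u \<in> local_section M \<omega> n l"
      using tangent_Z_LV snd_tangent uT by (simp add: local_section_def tautological_def)
    have "tautological M1 \<omega>1 n l k (u1 k) = sec_push ?\<Phi>u k" for k
    proof (cases "k \<in> Z1")
      case True
      let ?i = "\<Sigma>' k"
      have i: "?i \<in> Z" "\<Sigma> ?i = k"
        using True tw.t_in tw.s_t by auto
      show ?thesis
        using snd_lift_apply[OF i(1) tangent_Z_LV[OF i(1) uT[OF i(1)]]] sec_push_at[OF i(1), of u]
          sec_push_at[OF i(1), of ?\<Phi>u] i True u(2) by (simp add: tautological_def)
    qed (simp add: tautological_def vf_push_def)
    then have eq: "(\<lambda>k. tautological M1 \<omega>1 n l k (u1 k)) = sec_push ?\<Phi>u"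
      by blast
    have val: "pbc j X u \<in> LV"
      using pbc_cases is_E_connectionD(1)[of M \<omega> n l pbc j X u] j XT u(1) tangent_Z_LV[OF j] by auto
    have "tautological M1 \<omega>1 n l (\<Sigma> j) = snd (\<Sigma> j)"
      using lift_in[OF j] by (simp add: tautological_def)
    then have "induced_End pbc1 (\<Sigma> j) (D\<Sigma> X) (tautological M1 \<omega>1 n l) u1
        = L (pbc j X ?\<Phi>u) - snd (\<Sigma> j) (L (pbc j X u))"
      using econn_push_at[OF pbc_cases j XT loc] econn_push_at[OF pbc_cases j XT E_sections_local[OF u(1)]]
      by (simp only: induced_End_def eq pullback_connection_push u(2))
    also have "\<dots> = L (induced_End pbc j X (tautological M \<omega> n l) u)"
      using snd_lift_apply[OF j val] j by (simp only: induced_End_def differential_diff tautological_def if_True)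
    finally show ?thesis
      using hor[OF u(1)] by simp
  qed
  then show ?thesis
    using tw.push_tangent[OF XT j] by (simp add: horizontal_space_def)
qed

lemma J_horizontal_push:
  assumes j: "j \<in> Z" and X: "X \<in> tangent_space F j"
  shows "J_horizontal M1 \<omega>1 n l nabla1 (\<Sigma> j) (D\<Sigma> X) = D\<Sigma> (J_horizontal M \<omega> n l nabla j X)"
  unfolding J_horizontal_def
proof (rule the_unique_transport[where k = D\<Sigma>'])
  interpret Fl: twistor_conn_iso M1 M t s \<omega>1 \<omega> n l nabla1 nabla
    by (rule conn_flip)
  have loc: "X \<in> local_vec F Z"
    by (rule tangent_Z_local[OF j X])
  note j1 = lift_in[OF j] and X1 = tw.push_tangent[OF X j]
  show "(D\<Sigma> Y \<in> horizontal_space M1 \<omega>1 n l nabla1 (\<Sigma> j) \<and> differential (Cinf M1) fst (D\<Sigma> Y) =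
      snd (\<Sigma> j) (differential (Cinf M1) fst (D\<Sigma> X))) \<and> D\<Sigma>' (D\<Sigma> Y) = Y"
    if Y: "Y \<in> horizontal_space M \<omega> n l nabla j \<and>
      differential (Cinf M) fst Y = snd j (differential (Cinf M) fst X)" for Y
  proof -
    have "Y \<in> local_vec F Z"
      using Y by (intro tangent_Z_local[OF j]) (simp add: horizontal_space_def)
    then show ?thesis
      using horizontal_push[OF j] Y dfst_push[OF loc] dfst_push[of Y] snd_lift_apply[OF j dfst_local[OF loc]]
        tw.pull_push by simp
  qed
  show "(D\<Sigma>' Y \<in> horizontal_space M \<omega> n l nabla j \<and> differential (Cinf M) fst (D\<Sigma>' Y) =
      snd j (differential (Cinf M) fst X)) \<and> D\<Sigma> (D\<Sigma>' Y) = Y"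
    if Y: "Y \<in> horizontal_space M1 \<omega>1 n l nabla1 (\<Sigma> j) \<and>
      differential (Cinf M1) fst Y = snd (\<Sigma> j) (differential (Cinf M1) fst (D\<Sigma> X))" for Y
  proof -
    have l1: "Y \<in> local_vec F1 Z1" "D\<Sigma> X \<in> local_vec F1 Z1"
      using Y X1 by (auto intro!: Fl.tangent_Z_local[OF j1] simp: horizontal_space_def)
    then show ?thesis
      using Fl.horizontal_push[OF j1, of Y] Y Fl.dfst_push[OF l1(1)] Fl.dfst_push[OF l1(2)]
        Fl.snd_lift_apply[OF j1 Fl.dfst_local[OF l1(2)]] Fl.tw.pull_push[OF l1(1)]
        tw.pull_push[OF loc] lift_inverse[OF j] by simp
  qed
qed (rule differential_0)

lemma vertical_push:
  assumes j: "j \<in> Z" and X: "X \<in> vertical_space M \<omega> n l j"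
  shows "D\<Sigma> X \<in> vertical_space M1 \<omega>1 n l (\<Sigma> j)"
  using X tw.push_tangent[OF _ j] dfst_push[OF tangent_Z_local[OF j]] by (simp add: vertical_space_def)

abbreviation "conjugate \<equiv> End_conj M M1 s t"

text \<open>The condition that characterizes \<^const>\<open>vertical_End\<close> is carried over to the other twistor space.\<close>

lemma vertical_End_step:
  assumes j: "j \<in> Z" and X: "X \<in> tangent_space F j"
    and B: "B \<in> tangent_End M (fst j)"
      "\<forall>Y\<in>vfields M. \<forall>f\<in>Cinf M. B (Y (fst j)) f = X (\<lambda>k. snd k (Y (fst k)) f)"
  shows "conjugate (fst j) B \<in> tangent_End M1 (fst (\<Sigma> j)) \<and> (\<forall>Y\<in>vfields M1. \<forall>f\<in>Cinf M1.
    conjugate (fst j) B (Y (fst (\<Sigma> j))) f = D\<Sigma> X (\<lambda>k. snd k (Y (fst k)) f))"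
proof (intro conjI ballI)
  have x: "fst j \<in> points M"
    by (rule twistor_spaceD(1)[OF j])
  show "conjugate (fst j) B \<in> tangent_End M1 (fst (\<Sigma> j))"
    using End_conj_in[OF x B(1)] by simp
  fix Y f assume Y: "Y \<in> vfields M1" and f: "f \<in> Cinf M1"
  let ?Y = "base.pull Y"
  note Y' = pull_vf[OF Y]
  have at: "Y (s p) = L (?Y p)" if "p \<in> points M" for p
    using base.push_vf_at[OF that, of ?Y] push_pull_vf[OF Y] by simp
  have YT: "?Y p \<in> tangent M p" if "p \<in> points M" for p
    using Y' that by (simp add: vector_fields_def)
  have "conjugate (fst j) B (Y (fst (\<Sigma> j))) f = L (B (?Y (fst j))) f"
    using End_conj_apply[OF x B(1) base.A.vfield_local[OF Y']] at[OF x] by simp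
  also have "\<dots> = B (?Y (fst j)) (f \<circ> s)"
    by (rule base.push_apply[OF tangent_LV[OF x tangent_EndD(1)[OF B(1) YT[OF x]]]])
  also have "\<dots> = X (\<lambda>k. snd k (?Y (fst k)) (f \<circ> s))"
    using B(2) Y' smooth_pull[OF f] by blast
  also have "\<dots> = X ((\<lambda>k. snd k (Y (fst k)) f) \<circ> \<Sigma>)"
  proof (rule local_vec_cong[OF tangent_Z_local[OF j X]])
    fix k assume k: "k \<in> Z"
    note y = twistor_spaceD(1)[OF k]
    show "snd k (?Y (fst k)) (f \<circ> s) = ((\<lambda>k. snd k (Y (fst k)) f) \<circ> \<Sigma>) k"
      using snd_lift_apply[OF k base.A.vfield_local[OF Y'], of "fst k"] at[OF y]
        base.push_apply[OF tangent_Z_LV[OF k snd_tangent[OF k YT[OF y]]], of f] by simp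
  qed
  also have "\<dots> = D\<Sigma> X (\<lambda>k. snd k (Y (fst k)) f)"
    by (rule tw.push_apply[OF tangent_Z_local[OF j X], symmetric])
  finally show "conjugate (fst j) B (Y (fst (\<Sigma> j))) f = D\<Sigma> X (\<lambda>k. snd k (Y (fst k)) f)" .
qed

lemma vertical_End_push:
  assumes j: "j \<in> Z" and X: "X \<in> tangent_space F j"
  shows "vertical_End M1 (\<Sigma> j) (D\<Sigma> X) = conjugate (fst j) (vertical_End M j X)"
  unfolding vertical_End_def
proof (rule the_unique_transport[where k = "End_conj M1 M t s (s (fst j))"])
  interpret Fl: twistor_conn_iso M1 M t s \<omega>1 \<omega> n l nabla1 nabla
    by (rule conn_flip)
  have x: "fst j \<in> points M" "s (fst j) \<in> points M1"
    using twistor_spaceD(1)[OF j] point_in(1) by auto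
  show "(conjugate (fst j) B \<in> tangent_End M1 (fst (\<Sigma> j)) \<and> (\<forall>Y\<in>vfields M1. \<forall>f\<in>Cinf M1.
      conjugate (fst j) B (Y (fst (\<Sigma> j))) f = D\<Sigma> X (\<lambda>k. snd k (Y (fst k)) f))) \<and>
      End_conj M1 M t s (s (fst j)) (conjugate (fst j) B) = B"
    if "B \<in> tangent_End M (fst j) \<and>
      (\<forall>Y\<in>vfields M. \<forall>f\<in>Cinf M. B (Y (fst j)) f = X (\<lambda>k. snd k (Y (fst k)) f))" for B
    using vertical_End_step[OF j X, of B] End_conj_inverse[OF x(1), of B] that by blast
  show "(End_conj M1 M t s (s (fst j)) B \<in> tangent_End M (fst j) \<and> (\<forall>Y\<in>vfields M. \<forall>f\<in>Cinf M.
      End_conj M1 M t s (s (fst j)) B (Y (fst j)) f = X (\<lambda>k. snd k (Y (fst k)) f))) \<and>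
      conjugate (fst j) (End_conj M1 M t s (s (fst j)) B) = B"
    if B: "B \<in> tangent_End M1 (fst (\<Sigma> j)) \<and>
      (\<forall>Y\<in>vfields M1. \<forall>f\<in>Cinf M1. B (Y (fst (\<Sigma> j))) f = D\<Sigma> X (\<lambda>k. snd k (Y (fst k)) f))" for B
  proof (intro conjI)
    have "D\<Sigma>' (D\<Sigma> X) = X"
      by (rule tw.pull_push[OF tangent_Z_local[OF j X]])
    then show "End_conj M1 M t s (s (fst j)) B \<in> tangent_End M (fst j)"
      "\<forall>Y\<in>vfields M. \<forall>f\<in>Cinf M.
        End_conj M1 M t s (s (fst j)) B (Y (fst j)) f = X (\<lambda>k. snd k (Y (fst k)) f)"
      using Fl.vertical_End_step[OF lift_in[OF j] tw.push_tangent[OF X j], of B] B lift_inverse[OF j]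
      by simp_all
    show "conjugate (fst j) (End_conj M1 M t s (s (fst j)) B) = B"
      using Fl.End_conj_inverse[OF x(2), of B] B point_inverse(1)[OF x(1)] by simp
  qed
  show "conjugate (fst j) 0 = 0"
    by (auto simp: End_conj_def)
qed

lemma zero_tangent_End: "0 \<in> tangent_End M x"
  by (auto simp: tangent_End_def)

lemma vertical_End_in: "vertical_End M j X \<in> tangent_End M (fst j)"
  using the_unique_cases[of "\<lambda>B. B \<in> tangent_End M (fst j) \<and>
     (\<forall>Y\<in>vfields M. \<forall>f\<in>Cinf M. B (Y (fst j)) f = X (\<lambda>k. snd k (Y (fst k)) f))"]
    zero_tangent_End[of "fst j"] unfolding vertical_End_def by (elim disjE) (blast, simp only:)

lemma snd_lift_conj:
  assumes j: "j \<in> Z" and B: "B \<in> tangent_End M (fst j)"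
  shows "snd (\<Sigma> j) \<circ> conjugate (fst j) B = conjugate (fst j) (snd j \<circ> B)"
proof
  fix w
  have x: "fst j \<in> points M" "snd j \<in> tangent_End M (fst j)"
    using twistor_spaceD[OF j] by auto
  show "(snd (\<Sigma> j) \<circ> conjugate (fst j) B) w = conjugate (fst j) (snd j \<circ> B) w"
  proof (cases "w \<in> tangent M1 (s (fst j))")
    case True
    then obtain v where v: "v \<in> tangent M (fst j)" "w = L v"
      using push_tangent_surj[OF x(1)] by blast
    then show ?thesis
      using True base.pull_push[OF tangent_LV[OF x(1) v(1)]]
        snd_lift_apply[OF j tangent_LV[OF x(1) tangent_EndD(1)[OF B v(1)]]]
      by (simp add: End_conj_def[of M M1 s t])
  next
    case False
    then show ?thesis
      using tangent_EndD(2)[OF twistor_spaceD(2)[OF lift_in[OF j]]]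
        tangent_End_at_0[OF twistor_spaceD(2)[OF lift_in[OF j]]] by (simp add: End_conj_def)
  qed
qed

lemma J_vertical_step:
  assumes j: "j \<in> Z" and X: "X \<in> tangent_space F j"
    and Y: "Y \<in> vertical_space M \<omega> n l j" "vertical_End M j Y = snd j \<circ> vertical_End M j X"
  shows "D\<Sigma> Y \<in> vertical_space M1 \<omega>1 n l (\<Sigma> j)"
    "vertical_End M1 (\<Sigma> j) (D\<Sigma> Y) = snd (\<Sigma> j) \<circ> vertical_End M1 (\<Sigma> j) (D\<Sigma> X)"
proof -
  have YT: "Y \<in> tangent_space F j"
    using Y(1) by (simp add: vertical_space_def)
  show "vertical_End M1 (\<Sigma> j) (D\<Sigma> Y) = snd (\<Sigma> j) \<circ> vertical_End M1 (\<Sigma> j) (D\<Sigma> X)"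
    unfolding vertical_End_push[OF j X] vertical_End_push[OF j YT] Y(2)
    by (rule snd_lift_conj[OF j vertical_End_in, symmetric])
qed (rule vertical_push[OF j Y(1)])

lemma J_vertical_push:
  assumes j: "j \<in> Z" and X: "X \<in> tangent_space F j"
  shows "J_vertical M1 \<omega>1 n l (\<Sigma> j) (D\<Sigma> X) = D\<Sigma> (J_vertical M \<omega> n l j X)"
  unfolding J_vertical_def
proof (rule the_unique_transport[where k = D\<Sigma>'])
  interpret Fl: twistor_conn_iso M1 M t s \<omega>1 \<omega> n l nabla1 nabla
    by (rule conn_flip)
  note j1 = lift_in[OF j] and X1 = tw.push_tangent[OF X j]
  show "(D\<Sigma> Y \<in> vertical_space M1 \<omega>1 n l (\<Sigma> j) \<and>
      vertical_End M1 (\<Sigma> j) (D\<Sigma> Y) = snd (\<Sigma> j) \<circ> vertical_End M1 (\<Sigma> j) (D\<Sigma> X)) \<and> D\<Sigma>' (D\<Sigma> Y) = Y"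
    if Y: "Y \<in> vertical_space M \<omega> n l j \<and> vertical_End M j Y = snd j \<circ> vertical_End M j X" for Y
  proof -
    have "Y \<in> local_vec F Z"
      using Y by (intro tangent_Z_local[OF j]) (simp add: vertical_space_def)
    then show ?thesis
      using J_vertical_step[OF j X, of Y] Y tw.pull_push by blast
  qed
  show "(D\<Sigma>' Y \<in> vertical_space M \<omega> n l j \<and>
      vertical_End M j (D\<Sigma>' Y) = snd j \<circ> vertical_End M j X) \<and> D\<Sigma> (D\<Sigma>' Y) = Y"
    if Y: "Y \<in> vertical_space M1 \<omega>1 n l (\<Sigma> j) \<and>
      vertical_End M1 (\<Sigma> j) Y = snd (\<Sigma> j) \<circ> vertical_End M1 (\<Sigma> j) (D\<Sigma> X)" for Y
  proof -
    have "Y \<in> local_vec F1 Z1"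
      using Y by (intro Fl.tangent_Z_local[OF j1]) (simp add: vertical_space_def)
    then show ?thesis
      using Fl.J_vertical_step[OF j1 X1, of Y] Y Fl.tw.pull_push[of Y]
        tw.pull_push[OF tangent_Z_local[OF j X]] lift_inverse[OF j] by simp
  qed
qed (rule differential_0)

lemma J_horizontal_tangent: "J_horizontal M \<omega> n l nabla j X \<in> tangent_space F j"
  using the_unique_cases[of "\<lambda>Y. Y \<in> horizontal_space M \<omega> n l nabla j \<and>
     differential (Cinf M) fst Y = snd j (differential (Cinf M) fst X)"]
    zero_in_tangent[of F j]
  unfolding J_horizontal_def by (metis (no_types, lifting) horizontal_space_def mem_Collect_eq)

lemma J_vertical_tangent: "J_vertical M \<omega> n l j X \<in> tangent_space F j"
  using the_unique_cases[of "\<lambda>Y. Y \<in> vertical_space M \<omega> n l j \<and>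
     vertical_End M j Y = snd j \<circ> vertical_End M j X"] zero_in_tangent[of F j]
  unfolding J_vertical_def by (metis (no_types, lifting) vertical_space_def mem_Collect_eq)

lemma J_twistor_step:
  assumes j: "j \<in> Z"
    and Xh: "Xh \<in> horizontal_space M \<omega> n l nabla j" and Xv: "Xv \<in> vertical_space M \<omega> n l j"
    and X: "X = Xh + Xv" and Y: "Y = J_horizontal M \<omega> n l nabla j Xh + J_vertical M \<omega> n l j Xv"
  shows "(\<exists>Xh\<in>horizontal_space M1 \<omega>1 n l nabla1 (\<Sigma> j). \<exists>Xv\<in>vertical_space M1 \<omega>1 n l (\<Sigma> j).
      D\<Sigma> X = Xh + Xv \<and>
      D\<Sigma> Y = J_horizontal M1 \<omega>1 n l nabla1 (\<Sigma> j) Xh + J_vertical M1 \<omega>1 n l (\<Sigma> j) Xv) \<and>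
    D\<Sigma>' (D\<Sigma> Y) = Y"
proof (intro conjI bexI)
  have T: "Xh \<in> tangent_space F j" "Xv \<in> tangent_space F j"
    using Xh Xv by (auto simp: horizontal_space_def vertical_space_def)
  show "D\<Sigma>' (D\<Sigma> Y) = Y"
    unfolding Y
    by (intro tw.pull_push tangent_Z_local[OF j] tangent_add J_horizontal_tangent J_vertical_tangent)
  show "D\<Sigma> X = D\<Sigma> Xh + D\<Sigma> Xv"
    by (simp only: X differential_add)
  show "D\<Sigma> Y = J_horizontal M1 \<omega>1 n l nabla1 (\<Sigma> j) (D\<Sigma> Xh) + J_vertical M1 \<omega>1 n l (\<Sigma> j) (D\<Sigma> Xv)"
    by (simp only: Y differential_add J_horizontal_push[OF j T(1)] J_vertical_push[OF j T(2)])
qed (use horizontal_push[OF j Xh] vertical_push[OF j Xv] in auto)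

lemma J_twistor_push:
  assumes j: "j \<in> Z" and X: "X \<in> tangent_space F j"
  shows "J_twistor M1 \<omega>1 n l nabla1 (\<Sigma> j) (D\<Sigma> X) = D\<Sigma> (J_twistor M \<omega> n l nabla j X)"
  unfolding J_twistor_def
proof (rule the_unique_transport[where h = D\<Sigma> and k = D\<Sigma>'], goal_cases)
  case (1 Y)
  then show ?case
    using J_twistor_step[OF j] by blast
next
  case (2 Y)
  interpret Fl: twistor_conn_iso M1 M t s \<omega>1 \<omega> n l nabla1 nabla
    by (rule conn_flip)
  from 2 obtain Xh Xv where "Xh \<in> horizontal_space M1 \<omega>1 n l nabla1 (\<Sigma> j)"
    "Xv \<in> vertical_space M1 \<omega>1 n l (\<Sigma> j)" "D\<Sigma> X = Xh + Xv"
    "Y = J_horizontal M1 \<omega>1 n l nabla1 (\<Sigma> j) Xh + J_vertical M1 \<omega>1 n l (\<Sigma> j) Xv"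
    by blast
  from Fl.J_twistor_step[OF lift_in[OF j] this] show ?case
    by (simp only: lift_inverse[OF j] tw.pull_push[OF tangent_Z_local[OF j X]])
qed (rule differential_0)

lemma lift_pseudo_holomorphic:
  "pseudo_holomorphic (End_atlas M) Z (J_twistor M \<omega> n l nabla)
    (End_atlas M1) Z1 (J_twistor M1 \<omega>1 n l nabla1) \<Sigma>"
  unfolding pseudo_holomorphic_def twistor_funs_def[symmetric]
  using lift_smooth J_twistor_push by simp

end

theorem theorem4p1:
  fixes M :: "('a, 'e::euclidean_space) atlas" and M1 :: "('b, 'e) atlas"
    and \<omega> :: "'a form2" and \<omega>1 :: "'b form2"
    and \<sigma> :: "'a \<Rightarrow> 'b" and nabla :: "'a conn" and n l :: nat
  assumes "DIM('e) = 2 * n" and "l \<le> n"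
    and "symplectic_manifold M \<omega>" and "symplectic_manifold M1 \<omega>1"
    and "symplectomorphism M \<omega> M1 \<omega>1 \<sigma>"
    and "symplectic_connection M \<omega> nabla"
  defines "nabla1 \<equiv> push_connection M M1 \<sigma> nabla"
    and "\<Sigma> \<equiv> twistor_lift M M1 \<sigma>"
  shows "symplectic_connection M1 \<omega>1 nabla1
    \<and> (\<forall>j\<in>twistor_space M \<omega> n l. fst (\<Sigma> j) = \<sigma> (fst j))
    \<and> pseudo_holomorphic
        (End_atlas M) (twistor_space M \<omega> n l) (J_twistor M \<omega> n l nabla)
        (End_atlas M1) (twistor_space M1 \<omega>1 n l) (J_twistor M1 \<omega>1 n l nabla1) \<Sigma>"
proof -
  define \<tau> where "\<tau> = inv_into (points M) \<sigma>"
  have M: "smooth_manifold M" "smooth_manifold M1"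
    using assms(3,4) by (simp_all add: symplectic_manifold_def)
  have diff: "bij_betw \<sigma> (points M) (points M1)" "smooth_map M (points M) M1 (points M1) \<sigma>"
      "smooth_map M1 (points M1) M (points M) \<tau>"
    and form: "\<forall>p\<in>points M. \<forall>v\<in>tangent M p. \<forall>w\<in>tangent M p.
      \<omega>1 (\<sigma> p) (differential (Cinf M1) \<sigma> v) (differential (Cinf M1) \<sigma> w) = \<omega> p v w"
    using assms(5) by (simp_all add: symplectomorphism_def diffeomorphism_def \<tau>_def)
  have inj: "inj_on \<sigma> (points M)"
    using diff(1) by (rule bij_betw_imp_inj_on)
  have pt: "\<sigma> x \<in> points M1" "\<tau> (\<sigma> x) = x" if "x \<in> points M" for x
    using that diff(1) inj by (auto simp: \<tau>_def bij_betw_def)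
  have pt1: "\<tau> y \<in> points M" "\<sigma> (\<tau> y) = y" if "y \<in> points M1" for y
  proof -
    have y: "y \<in> \<sigma> ` points M"
      unfolding bij_betw_imp_surj_on[OF diff(1)] by (rule that)
    show "\<tau> y \<in> points M" "\<sigma> (\<tau> y) = y"
      unfolding \<tau>_def by (rule inv_into_into[OF y], rule f_inv_into_f[OF y])
  qed
  interpret twistor_iso M M1 \<sigma> \<tau> \<omega> \<omega>1 n l
  proof
    show "is_chart c" if "c \<in> M" for c
      using M(1) that unfolding smooth_manifold_def by blast
    show "is_chart d" if "d \<in> M1" for d
      using M(2) that unfolding smooth_manifold_def by blast
    show "(\<sigma> ` U, \<phi> \<circ> \<tau>) \<in> M1" if "(U, \<phi>) \<in> M" for U \<phi>
      by (rule push_chart[OF M diff(2,3) pt(2) pt1(2) that])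
    show "(\<tau> ` V, \<psi> \<circ> \<sigma>) \<in> M" if "(V, \<psi>) \<in> M1" for V \<psi>
      by (rule push_chart[OF M(2,1) diff(3,2) pt1(2) pt(2) that])
  qed (use pt pt1 form in auto)
  have inv_\<tau>: "inv_into (points M1) \<tau> x = \<sigma> x" if "x \<in> points M" for x
    using inv_into_f_f[of \<tau> "points M1" "\<sigma> x"] pt[OF that] pt1(2) by (metis inj_on_inverseI)
  have push: "push_vfield M M1 \<sigma> = base.push"
    by (auto simp: push_vfield_def vf_push_def \<tau>_def fun_eq_iff)
  have pull: "push_vfield M1 M \<tau> = base.pull"
    by (auto simp: push_vfield_def vf_push_def inv_\<tau> fun_eq_iff)
  have nabla1: "nabla1 = conn_push nabla"
    by (simp add: nabla1_def push_connection_def push pull flip: \<tau>_def)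
  have \<Sigma>: "\<Sigma> = End_lift M M1 \<sigma> \<tau>"
    by (auto simp: \<Sigma>_def twistor_lift_def End_lift_def End_conj_def \<tau>_def fun_eq_iff)
  interpret twistor_conn_iso M M1 \<sigma> \<tau> \<omega> \<omega>1 n l nabla nabla1
  proof
    show "nabla X Y \<in> vfields M" if "X \<in> vfields M" "Y \<in> vfields M" for X Y
      using assms(6) that by (simp add: symplectic_connection_def linear_connection_def)
    show "nabla1 (base.push X) (base.push Y) = base.push (nabla X Y)"
      if "X \<in> vfields M" "Y \<in> vfields M" for X Y
      using that by (simp add: nabla1 base.pull_push_vfield)
  qed
  show ?thesis
    using symplectic_connection_push[OF assms(6)] lift_pseudo_holomorphic by (simp add: nabla1 \<Sigma>)
qed

end
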